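(* The following decision problem is in $\mathsf{P}$ (deterministic polynomial time). Input: a prime $p$ in binary and matrices $C_1,\ldots,C_k\in \mathrm{T}(2,p)$. Question: do there exist $Z_1,\ldots,Z_k\in \mathrm{T}(2,p)$ with $\prod_{i=1}^k Z_i^{-1}C_iZ_i=I$?
   Context: $\mathrm{T}(2,p)$ is the group of all invertible upper triangular $2\times 2$ matrices over $\mathbb{Z}_p=\mathbb{Z}/p\mathbb{Z}$. Matrix entries are given in binary. $I$ is the identity matrix. *)

theory Defs
  imports
    "HOL-Analysis.Finite_Cartesian_Product"
    "HOL-Computational_Algebra.Polynomial"
    "HOL-Computational_Algebra.Primes"
    "HOL-Number_Theory.Residues"
begin

section \<open>Deterministic multitape Turing machines and the class P\<close>

text \<open>
  States and tape symbols are initial segments of the natural numbers; symbol 0 is the blank and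
  state 0 the initial state. Tapes are infinite in both directions, and every head may read, write
  and move on every tape. The values of the transition function outside the finite domain singled
  out by \<open>wf_tm\<close> are irrelevant: no run started on an input word reaches them.
\<close>

datatype move = Left | Stay | Right

record tm =
  tapes :: nat
  symbols :: nat
  states :: nat
  acc :: nat
  rej :: nat
  trans :: "nat \<Rightarrow> nat list \<Rightarrow> nat \<times> (nat \<times> move) list"

definition wf_tm :: "tm \<Rightarrow> bool" where
  "wf_tm M \<longleftrightarrow>
     0 < tapes M \<and> 0 < symbols M \<and> 0 < states M \<and>
     acc M < states M \<and> rej M < states M \<and> acc M \<noteq> rej M \<and>
     (\<forall>q < states M. \<forall>r \<in> lists {..<symbols M}. length r = tapes M \<longrightarrow>
        fst (trans M q r) < states M \<and>
        length (snd (trans M q r)) = tapes M \<and>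
        (\<forall>(s, d) \<in> set (snd (trans M q r)). s < symbols M))"

type_synonym tape = "(int \<Rightarrow> nat) \<times> int"  \<comment> \<open>contents and head position\<close>
type_synonym config = "nat \<times> tape list"

definition read_tape :: "tape \<Rightarrow> nat" where
  "read_tape t = fst t (snd t)"

fun shift :: "move \<Rightarrow> int \<Rightarrow> int" where
  "shift Left i = i - 1"
| "shift Stay i = i"
| "shift Right i = i + 1"

fun act :: "nat \<times> move \<Rightarrow> tape \<Rightarrow> tape" where
  "act (s, d) (c, i) = (c(i := s), shift d i)"

definition halted :: "tm \<Rightarrow> config \<Rightarrow> bool" where
  "halted M c \<longleftrightarrow> fst c = acc M \<or> fst c = rej M"

definition step :: "tm \<Rightarrow> config \<Rightarrow> config" where
  "step M c =
     (if halted M c then c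
      else let (q, as) = trans M (fst c) (map read_tape (snd c)) in (q, map2 act as (snd c)))"

definition blank_tape :: tape where
  "blank_tape = ((\<lambda>i. 0), 0)"

definition input_tape :: "nat list \<Rightarrow> tape" where
  "input_tape w = ((\<lambda>i. if 0 \<le> i \<and> i < int (length w) then w ! nat i else 0), 0)"

definition init_config :: "tm \<Rightarrow> nat list \<Rightarrow> config" where
  "init_config M w = (0, input_tape w # replicate (tapes M - 1) blank_tape)"

definition run :: "tm \<Rightarrow> nat \<Rightarrow> nat list \<Rightarrow> config" where
  "run M t w = (step M ^^ t) (init_config M w)"

definition decides_in_time :: "tm \<Rightarrow> nat \<Rightarrow> nat list set \<Rightarrow> (nat \<Rightarrow> nat) \<Rightarrow> bool" where
  "decides_in_time M s L T \<longleftrightarrow>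
     (\<forall>w \<in> lists {1..s}. \<exists>t \<le> T (length w). fst (run M t w) = (if w \<in> L then acc M else rej M))"

text \<open>The class P of the languages over the input alphabet \<open>{1..s}\<close>.\<close>

definition class_P :: "nat \<Rightarrow> nat list set set" where
  "class_P s =
     {L. L \<subseteq> lists {1..s} \<and>
         (\<exists>M (f :: nat poly). wf_tm M \<and> s < symbols M \<and> decides_in_time M s L (poly f))}"

text \<open>
  A decision problem consists of a set \<open>D\<close> of instances, an encoding of the instances as words over
  \<open>{1..s}\<close>, and a question \<open>Q\<close>. Being an instance is a property that the input is given to have:
  the machine halts in polynomial time on every word, and its answer has to be the answer to \<open>Q\<close>
  on the words that encode instances.
\<close>

definition problem_in_P :: "nat \<Rightarrow> ('a \<Rightarrow> nat list) \<Rightarrow> 'a set \<Rightarrow> ('a \<Rightarrow> bool) \<Rightarrow> bool" where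
  "problem_in_P s enc D Q \<longleftrightarrow> (\<exists>L \<in> class_P s. \<forall>x \<in> D. enc x \<in> lists {1..s} \<and> (enc x \<in> L \<longleftrightarrow> Q x))"


section \<open>The group \<open>T(2,p)\<close>\<close>

definition mat2_monoid :: "('a, 'm) ring_scheme \<Rightarrow> ('a ^ 2 ^ 2) monoid" where
  "mat2_monoid R =
     \<lparr>carrier = {A. \<forall>i j. A $ i $ j \<in> carrier R},
      monoid.mult = \<lambda>A B. \<chi> i j. \<Oplus>\<^bsub>R\<^esub>k \<in> UNIV. A $ i $ k \<otimes>\<^bsub>R\<^esub> B $ k $ j,
      one = \<chi> i j. if i = j then \<one>\<^bsub>R\<^esub> else \<zero>\<^bsub>R\<^esub>\<rparr>"

definition T2 :: "nat \<Rightarrow> (int ^ 2 ^ 2) monoid" where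
  "T2 p = (mat2_monoid (residue_ring (int p)))
     \<lparr>carrier := {A \<in> Units (mat2_monoid (residue_ring (int p))).
                   A $ 2 $ 1 = \<zero>\<^bsub>residue_ring (int p)\<^esub>}\<rparr>"


section \<open>Instances and their encoding\<close>

text \<open>
  Words over \<open>{1, 2, 3}\<close>: the symbols 1 and 2 are the binary digits 0 and 1, and 3 is a separator.
  Numbers are written with the most significant digit first and without leading zeros.
\<close>

fun bin :: "nat \<Rightarrow> nat list" where
  "bin n = (if n < 2 then [n + 1] else bin (n div 2) @ [n mod 2 + 1])"

declare bin.simps [simp del]

text \<open>Entries of matrices over \<open>\<int>\<^sub>p\<close> are represented in \<open>{0..p - 1}\<close>, hence are nonnegative.\<close>

definition enc_mat :: "int ^ 2 ^ 2 \<Rightarrow> nat list" where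
  "enc_mat A = concat (map (\<lambda>x. 3 # bin (nat x)) [A $ 1 $ 1, A $ 1 $ 2, A $ 2 $ 1, A $ 2 $ 2])"

definition enc_instance :: "nat \<times> (int ^ 2 ^ 2) list \<Rightarrow> nat list" where
  "enc_instance = (\<lambda>(p, Cs). bin p @ concat (map enc_mat Cs))"

end

theory Submission
  imports Defs "HOL-Analysis.Cartesian_Space" "HOL-Library.Countable"
begin

text \<open>
  Write \<open>C = (a, b; 0, d)\<close>. If \<open>a \<noteq> d\<close>, the conjugates of \<open>C\<close> are all matrices with this diagonal;
  if \<open>a = d\<close>, the upper right entry of a conjugate is an arbitrary nonzero residue or \<open>0\<close>, according
  to whether \<open>b \<noteq> 0\<close>. So the products of conjugates have a fixed diagonal, and their upper right
  entries form \<open>{0}\<close>, the nonzero residues or all residues: two nonzero summands give everything if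
  \<open>p\<close> is odd, and cancel if \<open>p = 2\<close>. The answer is yes iff both diagonal products are \<open>1\<close> and the
  upper right entries are not just the nonzero ones.

  Both diagonal products are computed by Horner's scheme, \<open>R \<mapsto> 2R + Y\<close> or \<open>R \<mapsto> 2R\<close> modulo \<open>p\<close>
  for each binary digit of the input, most significant first. All registers lie on one work tape, one
  track each, with the width of \<open>p\<close>. One sweep over this tape performs such a step, so
  the running time is quadratic.
\<close>

section \<open>Products of conjugates in \<open>T(2,p)\<close>\<close>

definition tri :: "int \<Rightarrow> int \<Rightarrow> int \<Rightarrow> int ^ 2 ^ 2" where
  "tri a b d = (\<chi> i j. if i = 1 then if j = 1 then a else b else if j = 1 then 0 else d)"

lemma tri_nth [simp]:
  "tri a b d $ 1 $ 1 = a" "tri a b d $ 1 $ 2 = b" "tri a b d $ 2 $ 1 = 0" "tri a b d $ 2 $ 2 = d"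
  by (simp_all add: tri_def)

lemma matrix_eq_iff_2:
  "A = B \<longleftrightarrow> A $ 1 $ 1 = B $ 1 $ 1 \<and> A $ 1 $ 2 = B $ 1 $ 2 \<and> A $ 2 $ 1 = B $ 2 $ 1 \<and> A $ 2 $ 2 = B $ 2 $ 2"
  for A B :: "'a ^ 2 ^ 2"
  by (simp add: vec_eq_iff forall_2)

lemma tri_inject [simp]: "tri a b d = tri a' b' d' \<longleftrightarrow> a = a' \<and> b = b' \<and> d = d'"
  by (simp add: matrix_eq_iff_2)

lemma mod_lin:
  "(u * (v mod m) + w) mod m = (u * v + w) mod m" "(w + u * (v mod m)) mod m = (w + u * v) mod m"
  "((v mod m) * u + w) mod m = (v * u + w) mod m" "(w + (v mod m) * u) mod m = (w + v * u) mod m"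
  for m :: int
  by (fold cong_def; intro cong_add cong_mult cong_refl; simp add: cong_def)+

locale T2_prime =
  fixes p :: nat and P :: int and G (structure)
  assumes prime_p: "prime p"
  defines P_def: "P \<equiv> int p"
  defines G_def: "G \<equiv> T2 p"
begin

lemma prime_P: "prime P"
  using prime_p by (simp add: P_def)

lemma P_gt_1: "1 < P"
  using prime_gt_1_int[OF prime_P] .

sublocale residues P "residue_ring P"
  by unfold_locales (rule P_gt_1)

lemma mod_P_range: "0 \<le> x mod P" "x mod P < P"
  using P_gt_1 by simp_all

lemma prod_nonzero: "0 < (x * y) mod P" if "x \<in> {1..<P}" "y \<in> {1..<P}"
proof -
  have "\<not> P dvd x" "\<not> P dvd y"
    using that by (auto dest: zdvd_imp_le)
  then have "\<not> P dvd x * y"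
    using prime_P by (simp add: prime_dvd_mult_iff)
  then show ?thesis
    using mod_P_range(1)[of "x * y"] by (simp add: dvd_eq_mod_eq_0 order_less_le)
qed

lemma coprime_P: "coprime x P" if "x \<in> {1..<P}"
proof -
  have "\<not> P dvd x"
    using that by (auto dest: zdvd_imp_le)
  then show ?thesis
    using prime_P by (simp add: coprime_commute prime_imp_coprime)
qed

lemma ex_inverse:
  assumes "\<not> P dvd x"
  obtains y where "y \<in> {1..<P}" "(x * y) mod P = 1"
proof -
  have "coprime x P"
    using prime_P assms by (simp add: coprime_commute prime_imp_coprime)
  then obtain y where "[x * y = 1] (mod P)"
    using cong_solve_coprime_int by blast
  then have y: "(x * (y mod P)) mod P = 1"
    using P_gt_1 by (simp add: cong_def mod_simps)
  then have "y mod P \<noteq> 0"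
    by auto
  then show thesis
    using that y mod_P_range[of y] by (metis atLeastLessThan_iff int_one_le_iff_zero_less order_less_le)
qed

lemma eq_of_cong: "x = y" if "[x = y] (mod P)" "x \<in> {0..<P}" "y \<in> {0..<P}"
  using that by (simp add: cong_def)

lemma finsum_UNIV_2:
  fixes f :: "2 \<Rightarrow> int"
  assumes "\<And>k. f k \<in> {0..<P}"
  shows "(\<Oplus>\<^bsub>residue_ring P\<^esub>k \<in> UNIV. f k) = (f 1 + f 2) mod P"
proof -
  have "f k \<in> carrier (residue_ring P)" for k
    using assms[of k] by (simp add: residue_ring_def)
  moreover have "f k mod P = f k" for k
    using assms[of k] by simp
  ultimately show ?thesis
    by (simp add: UNIV_2 finsum_insert Pi_def res_add_eq)
      (simp add: residue_ring_def mod_simps)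
qed

lemma carrier_mat2: "A \<in> carrier (mat2_monoid (residue_ring P)) \<longleftrightarrow> (\<forall>i j. A $ i $ j \<in> {0..<P})"
  by (auto simp: mat2_monoid_def residue_ring_def)

lemma mult_mat2_nth:
  "(A \<otimes>\<^bsub>mat2_monoid (residue_ring P)\<^esub> B) $ i $ j = (A $ i $ 1 * B $ 1 $ j + A $ i $ 2 * B $ 2 $ j) mod P"
proof -
  have "(A \<otimes>\<^bsub>mat2_monoid (residue_ring P)\<^esub> B) $ i $ j =
      (\<Oplus>\<^bsub>residue_ring P\<^esub>k \<in> UNIV. (A $ i $ k * B $ k $ j) mod P)"
    by (simp add: mat2_monoid_def residue_ring_def)
  then show ?thesis
    using P_gt_1 by (simp add: finsum_UNIV_2 mod_simps)
qed

lemma one_mat2: "\<one>\<^bsub>mat2_monoid (residue_ring P)\<^esub> = tri 1 0 1"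
  by (simp add: mat2_monoid_def residue_ring_def matrix_eq_iff_2)

lemma one_G: "\<one> = tri 1 0 1"
  by (simp add: G_def T2_def flip: P_def one_mat2)

lemma mult_G_nth: "(A \<otimes> B) $ i $ j = (A $ i $ 1 * B $ 1 $ j + A $ i $ 2 * B $ 2 $ j) mod P"
  by (simp add: G_def T2_def flip: P_def mult_mat2_nth)

lemma mult_tri:
  "tri a b d \<otimes> tri a' b' d' = tri ((a * a') mod P) ((a * b' + b * d') mod P) ((d * d') mod P)"
  by (simp add: matrix_eq_iff_2 mult_G_nth)

text \<open>Solving for the upper right entry of the inverse gives \<open>- b / (a * d)\<close>.
  Both orders of the product are recorded because \<open>Units\<close> demands a two-sided
  inverse.\<close>

lemma ex_left_inverse:
  assumes "a \<in> {1..<P}" "d \<in> {1..<P}"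
  obtains a' b' d' where "a' \<in> {1..<P}" "b' \<in> {0..<P}" "d' \<in> {1..<P}"
    "tri a' b' d' \<otimes> tri a b d = tri 1 0 1" "tri a b d \<otimes> tri a' b' d' = tri 1 0 1"
proof -
  have "\<not> P dvd a" "\<not> P dvd d"
    using assms by (auto dest: zdvd_imp_le)
  then obtain a' d' where a': "a' \<in> {1..<P}" "(a * a') mod P = 1"
    and d': "d' \<in> {1..<P}" "(d * d') mod P = 1"
    using ex_inverse by metis
  define b' where "b' = (- a' * b * d') mod P"
  have "[a * b' + b * d' = (1 - a * a') * (b * d')] (mod P)"
    unfolding b'_def cong_def mod_lin by (simp add: algebra_simps)
  also have "[(1 - a * a') * (b * d') = (1 - 1) * (b * d')] (mod P)"
    using a'(2) P_gt_1 by (intro cong_mult cong_diff) (simp_all add: cong_def)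
  finally have 1: "(a * b' + b * d') mod P = 0"
    by (simp add: cong_def)
  have "[a' * b + b' * d = a' * b * (1 - d * d')] (mod P)"
    unfolding b'_def cong_def mod_lin by (simp add: algebra_simps)
  also have "[a' * b * (1 - d * d') = a' * b * (1 - 1)] (mod P)"
    using d'(2) P_gt_1 by (intro cong_mult cong_diff) (simp_all add: cong_def)
  finally have 2: "(a' * b + b' * d) mod P = 0"
    by (simp add: cong_def)
  show thesis
    using that[of a' b' d'] a' d' 1 2 mod_P_range by (simp add: mult_tri mult.commute b'_def)
qed

lemma carrier_G: "carrier G = {tri a b d | a b d. a \<in> {1..<P} \<and> b \<in> {0..<P} \<and> d \<in> {1..<P}}"
  (is "_ = ?T")
proof (intro equalityI subsetI)
  fix A assume "A \<in> carrier G"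
  then have "A \<in> Units (mat2_monoid (residue_ring P))" and A21: "A $ 2 $ 1 = 0"
    by (simp_all add: G_def T2_def residue_ring_def P_def)
  then obtain B where A: "\<And>i j. A $ i $ j \<in> {0..<P}"
    and BA: "B \<otimes>\<^bsub>mat2_monoid (residue_ring P)\<^esub> A = tri 1 0 1"
    and AB: "A \<otimes>\<^bsub>mat2_monoid (residue_ring P)\<^esub> B = tri 1 0 1"
    by (auto simp: Units_def carrier_mat2 one_mat2)
  \<comment> \<open>Because the lower left entry of \<open>A\<close> vanishes, these entries of the
    two products are single products, which forces the diagonal of \<open>A\<close> to be
    nonzero.\<close>
  have "(B $ 1 $ 1 * A $ 1 $ 1) mod P = 1" "(A $ 2 $ 2 * B $ 2 $ 2) mod P = 1"
    using arg_cong[OF BA, of "\<lambda>M. M $ 1 $ 1"] arg_cong[OF AB, of "\<lambda>M. M $ 2 $ 2"] A21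
    by (simp_all add: mult_mat2_nth)
  then have "A $ 1 $ 1 \<noteq> 0" "A $ 2 $ 2 \<noteq> 0"
    by auto
  then have "A = tri (A $ 1 $ 1) (A $ 1 $ 2) (A $ 2 $ 2) \<and> A $ 1 $ 1 \<in> {1..<P} \<and>
      A $ 1 $ 2 \<in> {0..<P} \<and> A $ 2 $ 2 \<in> {1..<P}"
    using A[of 1 1] A[of 2 2] A[of 1 2] A21 by (auto simp: matrix_eq_iff_2)
  then show "A \<in> ?T"
    by blast
next
  fix A assume "A \<in> ?T"
  then obtain a b d where A: "A = tri a b d" "a \<in> {1..<P}" "b \<in> {0..<P}" "d \<in> {1..<P}"
    by blast
  then obtain a' b' d' where "a' \<in> {1..<P}" "b' \<in> {0..<P}" "d' \<in> {1..<P}"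
    "tri a' b' d' \<otimes> tri a b d = tri 1 0 1" "tri a b d \<otimes> tri a' b' d' = tri 1 0 1"
    using ex_left_inverse by metis
  with A have "A \<in> Units (mat2_monoid (residue_ring P))"
    unfolding Units_def
    by (auto simp: carrier_mat2 forall_2 matrix_eq_iff_2 mult_G_nth mult_mat2_nth one_mat2
        intro!: bexI[of _ "tri a' b' d'"])
  with A show "A \<in> carrier G"
    by (simp add: G_def T2_def residue_ring_def P_def)
qed

lemma tri_in_carrier [simp]:
  "tri a b d \<in> carrier G \<longleftrightarrow> a \<in> {1..<P} \<and> b \<in> {0..<P} \<and> d \<in> {1..<P}"
  by (auto simp: carrier_G)

lemma group_G: "group G"
proof (rule groupI)
  fix A B assume "A \<in> carrier G" "B \<in> carrier G"
  then show "A \<otimes> B \<in> carrier G"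
    using P_gt_1 prod_nonzero by (fastforce simp: carrier_G mult_tri)
next
  show "\<one> \<in> carrier G"
    using P_gt_1 by (simp add: one_G)
next
  fix A B C assume "A \<in> carrier G" "B \<in> carrier G" "C \<in> carrier G"
  then show "A \<otimes> B \<otimes> C = A \<otimes> (B \<otimes> C)"
    by (auto simp: carrier_G mult_tri mod_lin) (simp_all add: mod_simps algebra_simps)
next
  fix A assume "A \<in> carrier G"
  then show "\<one> \<otimes> A = A"
    by (auto simp: carrier_G mult_tri one_G)
next
  fix A assume "A \<in> carrier G"
  then obtain a b d where A: "A = tri a b d" "a \<in> {1..<P}" "d \<in> {1..<P}"
    by (auto simp: carrier_G)
  obtain a' b' d' where "a' \<in> {1..<P}" "b' \<in> {0..<P}" "d' \<in> {1..<P}"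
    "tri a' b' d' \<otimes> tri a b d = tri 1 0 1"
    using ex_left_inverse[OF A(2,3)] by metis
  then show "\<exists>B\<in>carrier G. B \<otimes> A = \<one>"
    by (intro bexI[of _ "tri a' b' d'"]) (simp_all add: A one_G)
qed

sublocale group G
  by (rule group_G)

section \<open>Conjugacy classes\<close>

definition conj_class :: "int ^ 2 ^ 2 \<Rightarrow> (int ^ 2 ^ 2) set" where
  "conj_class C = {inv Z \<otimes> C \<otimes> Z | Z. Z \<in> carrier G}"

text \<open>Trades the inverse of \<open>Z\<close> for an equation between two products, which can
  be compared entry by entry.\<close>

lemma conj_eq_iff: "inv Z \<otimes> C \<otimes> Z = W \<longleftrightarrow> C \<otimes> Z = Z \<otimes> W"
  if "Z \<in> carrier G" "C \<in> carrier G" "W \<in> carrier G"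
  using that inv_solve_left[of W Z "C \<otimes> Z"] by (auto simp: m_assoc)

text \<open>Comparing entries of \<open>C Z = Z W\<close> shows that the diagonal is kept. If
  \<open>a = d\<close>, the upper right entry of \<open>Z\<close> cancels, leaving
  \<open>b * z = x * w\<close> with units \<open>x\<close> and \<open>z\<close>.\<close>

lemma conj_class_tri:
  assumes C: "tri a b d \<in> carrier G"
  shows "conj_class (tri a b d) =
    {tri a w d | w. w \<in> {0..<P} \<and> (a = d \<longrightarrow> (w = 0 \<longleftrightarrow> b = 0))}" (is "_ = ?T")
proof (intro equalityI subsetI)
  fix W assume "W \<in> conj_class (tri a b d)"
  then obtain Z where Z: "Z \<in> carrier G" "W = inv Z \<otimes> tri a b d \<otimes> Z"
    by (auto simp: conj_class_def)
  with C have W: "W \<in> carrier G"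
    by blast
  with Z C have *: "tri a b d \<otimes> Z = Z \<otimes> W"
    by (simp flip: conj_eq_iff)
  obtain x y z where xyz: "Z = tri x y z" "x \<in> {1..<P}" "y \<in> {0..<P}" "z \<in> {1..<P}"
    using Z by (auto simp: carrier_G)
  obtain a' w d' where W_eq: "W = tri a' w d'" "a' \<in> {1..<P}" "w \<in> {0..<P}" "d' \<in> {1..<P}"
    using W by (auto simp: carrier_G)
  have e: "[a * x = a' * x] (mod P)" "[a * y + b * z = x * w + y * d'] (mod P)" "[d * z = d' * z] (mod P)"
    using * by (simp_all add: xyz W_eq mult_tri cong_def mult.commute)
  have ndvd: "\<not> P dvd x" "\<not> P dvd z"
    using xyz by (auto dest: zdvd_imp_le)
  then have "coprime x P" "coprime z P"
    using prime_P by (simp_all add: coprime_commute prime_imp_coprime)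
  with e have "[a = a'] (mod P)" "[d = d'] (mod P)"
    by (simp_all add: cong_mult_rcancel)
  then have ad: "a' = a" "d' = d"
    using C W_eq by (simp_all add: cong_def)
  have "w = 0 \<longleftrightarrow> b = 0" if "a = d"
  proof -
    have "[b * z + d * y = x * w + d * y] (mod P)"
      using e(2) that ad by (simp add: ac_simps)
    then have "[b * z = x * w] (mod P)"
      by (simp only: cong_add_rcancel)
    then have "P dvd b * z \<longleftrightarrow> P dvd x * w"
      by (simp add: cong_def dvd_eq_mod_eq_0)
    then have "P dvd b \<longleftrightarrow> P dvd w"
      using ndvd prime_P by (simp add: prime_dvd_mult_iff)
    then show ?thesis
      using C W_eq by (auto simp: dvd_eq_mod_eq_0)
  qed
  then show "W \<in> ?T"
    using W_eq ad by blast
next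
  fix W assume "W \<in> ?T"
  then obtain w where w: "W = tri a w d" "w \<in> {0..<P}" "a = d \<longrightarrow> (w = 0 \<longleftrightarrow> b = 0)"
    by blast
  have "\<exists>Z\<in>carrier G. tri a b d \<otimes> Z = Z \<otimes> W"
  proof (cases "a = d")
    case True
    show ?thesis
    proof (cases "b = 0")
      case True
      then show ?thesis
        using w \<open>a = d\<close> C by (intro bexI[of _ "tri 1 0 1"]) (auto simp: mult_tri P_gt_1)
    next
      case False
      then show ?thesis
        \<comment> \<open>A diagonal conjugator rescales \<open>b\<close> to \<open>w\<close>; it is
          invertible since \<open>b\<close> and \<open>w\<close> are both nonzero here.\<close>
        using w \<open>a = d\<close> C by (intro bexI[of _ "tri b 0 w"]) (auto simp: mult_tri mult.commute)
    qed
  next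
    case False
    then have "\<not> P dvd a - d"
      using C eq_of_cong[of a d] by (auto simp: cong_iff_dvd_diff)
    then obtain u where u: "((a - d) * u) mod P = 1"
      using ex_inverse by blast
    \<comment> \<open>As \<open>u\<close> inverts \<open>a - d\<close>, this solves
      \<open>(a - d) * y = w - b\<close>, the upper right entry of \<open>C Z = Z W\<close> for the
      unipotent \<open>Z = tri 1 y 1\<close>.\<close>
    define y where "y = (u * (w - b)) mod P"
    have "[a * y + b = (a - d) * u * (w - b) + b + y * d] (mod P)"
      unfolding y_def cong_def mod_lin by (simp add: algebra_simps)
    also have "[(a - d) * u * (w - b) + b + y * d = 1 * (w - b) + b + y * d] (mod P)"
      using u P_gt_1 by (intro cong_mult cong_add cong_refl) (simp add: cong_def)
    finally have "(a * y + b) mod P = (w + y * d) mod P"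
      by (simp add: cong_def)
    then show ?thesis
      using P_gt_1 by (intro bexI[of _ "tri 1 y 1"]) (simp_all add: w mult_tri y_def)
  qed
  moreover have "W \<in> carrier G"
    using w C by simp
  ultimately show "W \<in> conj_class (tri a b d)"
    using C by (auto simp: conj_class_def simp flip: conj_eq_iff)
qed

end

section \<open>Shapes: the three possible sets of upper right entries and their sums\<close>

definition add_unit_shape :: "bool \<Rightarrow> nat \<Rightarrow> nat" where
  "add_unit_shape odd_p s = (if s = 0 then 1 else if s = 1 \<and> \<not> odd_p then 0 else 2)"

text \<open>Shape \<open>0\<close> stands for \<open>{0}\<close>, \<open>1\<close> for the nonzero
  residues, \<open>2\<close> for all residues. The case \<open>t = 1\<close> is split off because
  the machine computes it in its control; it is also the only case that depends on the parity of
  \<open>p\<close>.\<close>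

definition add_shape :: "bool \<Rightarrow> nat \<Rightarrow> nat \<Rightarrow> nat" where
  "add_shape odd_p t s = (if t = 0 then s else if t = 1 then add_unit_shape odd_p s else 2)"

text \<open>Comparing \<open>A'\<close> with \<open>D'\<close> instead of the two diagonal entries of \<open>C\<close> is enough: if \<open>A \<noteq> D\<close>, the
  shape is already \<open>2\<close>, which absorbs everything.\<close>

definition summary_step :: "nat \<Rightarrow> int \<times> int \<times> nat \<Rightarrow> int ^ 2 ^ 2 \<Rightarrow> int \<times> int \<times> nat" where
  "summary_step p = (\<lambda>(A, D, s) C.
     let A' = (A * C $ 1 $ 1) mod int p; D' = (D * C $ 2 $ 2) mod int p
     in (A', D', if A' = D' then if C $ 1 $ 2 = 0 then s else add_unit_shape (odd p) s else 2))"

context T2_prime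
begin

definition shape_set :: "nat \<Rightarrow> int set" where
  "shape_set s = (if s = 0 then {0} else if s = 1 then {1..<P} else {0..<P})"

lemma shape_set_subset: "shape_set s \<subseteq> {0..<P}"
  using P_gt_1 by (auto simp: shape_set_def)

lemma mem_shape_set_iff:
  "x \<in> shape_set s \<longleftrightarrow> (s = 0 \<longrightarrow> x = 0) \<and> (s = 1 \<longrightarrow> x \<noteq> 0)" if "x \<in> {0..<P}"
  using that by (auto simp: shape_set_def)

lemma shape_set_nonempty: "shape_set s \<noteq> {}"
  using P_gt_1 by (auto simp: shape_set_def)

text \<open>Multiplication by a unit permutes the residues and fixes \<open>0\<close>, so it
  preserves each of the three sets.\<close>

lemma mult_unit_shape:
  assumes u: "u \<in> {1..<P}"
  shows "(\<lambda>w. (u * w) mod P) ` shape_set s = shape_set s"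
proof -
  have zero_iff: "(u * w) mod P = 0 \<longleftrightarrow> w = 0" if "w \<in> {0..<P}" for w
    using prod_nonzero[OF u, of w] that by (cases "w = 0") auto
  have surj: "\<exists>w\<in>{0..<P}. (u * w) mod P = x" if "x \<in> {0..<P}" for x
  proof -
    have "\<not> P dvd u"
      using u by (auto dest: zdvd_imp_le)
    then obtain u' where "(u * u') mod P = 1"
      using ex_inverse by blast
    moreover have "(u * (u' * x mod P)) mod P = ((u * u') mod P * x) mod P"
      by (simp add: mod_simps mult.assoc)
    ultimately have "(u * (u' * x mod P)) mod P = x"
      using that by simp
    then show ?thesis
      using mod_P_range by (intro bexI[of _ "u' * x mod P"]) simp_all
  qed
  have mem_iff: "(u * w) mod P \<in> shape_set s \<longleftrightarrow> w \<in> shape_set s" if "w \<in> {0..<P}" for w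
    using zero_iff[OF that] that mod_P_range[of "u * w"] by (simp add: mem_shape_set_iff)
  show ?thesis
  proof (intro equalityI subsetI)
    fix x assume "x \<in> (\<lambda>w. (u * w) mod P) ` shape_set s"
    then show "x \<in> shape_set s"
      using mem_iff shape_set_subset by blast
  next
    fix x assume "x \<in> shape_set s"
    then show "x \<in> (\<lambda>w. (u * w) mod P) ` shape_set s"
      using surj[of x] mem_iff shape_set_subset by blast
  qed
qed

lemma odd_p_iff: "odd p \<longleftrightarrow> P \<noteq> 2"
  using prime_p prime_odd_nat[of p] prime_ge_2_nat[of p] by (cases "p = 2") (auto simp: P_def)

text \<open>Modulo \<open>P\<close>, \<open>0 = 1 + (P - 1)\<close> and
  \<open>1 = 2 + (P - 1)\<close>, where \<open>2\<close> is a nonzero residue because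
  \<open>P > 2\<close>; every other \<open>x\<close> is \<open>1 + (x - 1)\<close>.\<close>

lemma sum_shape_1_1:
  assumes "x \<in> {0..<P}" "P \<noteq> 2"
  shows "\<exists>w\<in>{1..<P}. \<exists>v\<in>{1..<P}. x = (w + v) mod P"
proof -
  consider "x = 0" | "x = 1" | "1 < x"
    using assms by fastforce
  then show ?thesis
  proof cases
    case 1
    then show ?thesis
      using P_gt_1 by (intro bexI[of _ 1] bexI[of _ "P - 1"]) auto
  next
    case 2
    then show ?thesis
      using P_gt_1 assms by (intro bexI[of _ 2] bexI[of _ "P - 1"]) auto
  next
    case 3
    then show ?thesis
      using P_gt_1 assms by (intro bexI[of _ 1] bexI[of _ "x - 1"]) auto
  qed
qed

text \<open>\<open>{0}\<close> is neutral, and the full set absorbs every nonempty set because it is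
  invariant under translation. This leaves the sum of two copies of the nonzero residues.\<close>

lemma sum_shape:
  "{(w + v) mod P | w v. w \<in> shape_set t \<and> v \<in> shape_set s} = shape_set (add_shape (odd p) t s)"
proof -
  have full: "{(w + v) mod P | w v. w \<in> S \<and> v \<in> {0..<P}} = {0..<P}" if "S \<noteq> {}" for S
  proof (intro equalityI subsetI)
    fix x assume x: "x \<in> {0..<P}"
    from that obtain w where "w \<in> S"
      by blast
    moreover have "x = (w + (x - w) mod P) mod P"
      using x by (simp add: mod_simps)
    ultimately show "x \<in> {(w + v) mod P | w v. w \<in> S \<and> v \<in> {0..<P}}"
      using mod_P_range[of "x - w"] by auto
  qed (use mod_P_range in auto)
  have full': "{(w + v) mod P | w v. w \<in> {0..<P} \<and> v \<in> S} = {0..<P}" if "S \<noteq> {}" for S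
  proof -
    have "{(w + v) mod P | w v. w \<in> {0..<P} \<and> v \<in> S} = {(w + v) mod P | w v. w \<in> S \<and> v \<in> {0..<P}}"
      by (subst add.commute) blast
    with full[OF that] show ?thesis
      by simp
  qed
  consider "t = 0" | "t \<noteq> 0" "s = 0" | "1 < t" | "1 < s" | "t = 1" "s = 1" "P \<noteq> 2" | "t = 1" "s = 1" "P = 2"
    by linarith
  then show ?thesis
  proof cases
    case 1
    have "v mod P = v" if "v \<in> shape_set s" for v
      using that shape_set_subset[of s] by auto
    then have "(\<lambda>v. v mod P) ` shape_set s = shape_set s"
      by simp
    then show ?thesis
      unfolding 1 by (simp add: shape_set_def[of 0] add_shape_def setcompr_eq_image)
  next
    case 2
    have "v mod P = v" if "v \<in> shape_set t" for v
      using that shape_set_subset[of t] by auto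
    then have "(\<lambda>v. v mod P) ` shape_set t = shape_set t"
      by simp
    moreover have "shape_set (add_shape (odd p) t s) = shape_set t"
      using 2 by (simp add: shape_set_def add_shape_def add_unit_shape_def)
    ultimately show ?thesis
      unfolding 2(2) by (simp add: shape_set_def[of 0] setcompr_eq_image)
  next
    case 3
    then show ?thesis
      using full'[OF shape_set_nonempty[of s]]
      by (simp add: shape_set_def[of t] shape_set_def[of 2] add_shape_def)
  next
    case 4
    then show ?thesis
      using full[OF shape_set_nonempty[of t]]
      by (cases "t = 0")
          (auto simp: shape_set_def[of s] shape_set_def[of 2] add_shape_def add_unit_shape_def)
  next
    case 5
    then have "shape_set (add_shape (odd p) t s) = {0..<P}"
      by (simp add: add_shape_def add_unit_shape_def odd_p_iff shape_set_def)
    moreover have "shape_set t = {1..<P}" "shape_set s = {1..<P}"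
      using 5 by (simp_all add: shape_set_def)
    moreover have "{(w + v) mod P | w v. w \<in> {1..<P} \<and> v \<in> {1..<P}} = {0..<P}"
    proof (intro equalityI subsetI)
      fix x assume "x \<in> {0..<P}"
      then show "x \<in> {(w + v) mod P | w v. w \<in> {1..<P} \<and> v \<in> {1..<P}}"
        using sum_shape_1_1[of x] 5 by blast
    qed (use mod_P_range in auto)
    ultimately show ?thesis
      by simp
  next
    case 6
    then have "{1..<P} = {1}"
      by auto
    with 6 show ?thesis
      using odd_p_iff by (simp add: shape_set_def add_shape_def add_unit_shape_def)
  qed
qed

text \<open>The expression is the upper right entry of a product of two triangular matrices; its
  coefficients come from the diagonals, so they are units and preserve shapes.\<close>

lemma lin_comb_shape:
  assumes "u \<in> {1..<P}" "u' \<in> {1..<P}"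
  shows "{(u * w + v * u') mod P | w v. w \<in> shape_set t \<and> v \<in> shape_set s} =
    shape_set (add_shape (odd p) t s)"
proof -
  have eq: "(u * w + v * u') mod P = ((u * w) mod P + (u' * v) mod P) mod P" for w v
    by (simp add: mod_simps mult.commute)
  have "{(u * w + v * u') mod P | w v. w \<in> shape_set t \<and> v \<in> shape_set s} =
    {(w + v) mod P | w v. w \<in> (\<lambda>w. (u * w) mod P) ` shape_set t \<and> v \<in> (\<lambda>w. (u' * w) mod P) ` shape_set s}"
    unfolding eq by blast
  then show ?thesis
    by (simp only: assms mult_unit_shape sum_shape)
qed

section \<open>Products of conjugates of a list of matrices\<close>

definition conj_products :: "(int ^ 2 ^ 2) list \<Rightarrow> (int ^ 2 ^ 2) set" where
  "conj_products Cs = {foldr (\<otimes>) Ws \<one> | Ws. list_all2 (\<lambda>W C. W \<in> conj_class C) Ws Cs}"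

lemma conj_class_closed: "conj_class C \<subseteq> carrier G" if "C \<in> carrier G"
  using that by (auto simp: conj_class_def)

lemma foldr_mult:
  "foldr (\<otimes>) Ws X = foldr (\<otimes>) Ws \<one> \<otimes> X" if "set Ws \<subseteq> carrier G" "X \<in> carrier G"
proof -
  have "foldr (\<otimes>) Ws X = foldr (\<otimes>) Ws \<one> \<otimes> X \<and> foldr (\<otimes>) Ws \<one> \<in> carrier G"
    using that by (induction Ws) (auto simp: m_assoc)
  then show ?thesis ..
qed

text \<open>Appending at the end matches the left fold of \<open>summary_step\<close>, although the
  product is a right fold.\<close>

lemma conj_products_snoc:
  assumes "set (Cs @ [C]) \<subseteq> carrier G"
  shows "conj_products (Cs @ [C]) = {X \<otimes> W | X W. X \<in> conj_products Cs \<and> W \<in> conj_class C}"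
proof -
  have sub: "set Ws \<subseteq> carrier G" if "list_all2 (\<lambda>W C. W \<in> conj_class C) Ws Cs" for Ws
    using that assms conj_class_closed by induction auto
  have *: "foldr (\<otimes>) (Ws @ [W]) \<one> = foldr (\<otimes>) Ws \<one> \<otimes> W"
    if "list_all2 (\<lambda>W C. W \<in> conj_class C) Ws Cs" "W \<in> conj_class C" for Ws W
    using foldr_mult[OF sub[OF that(1)], of W] that(2) conj_class_closed[of C] assms by (auto simp: r_one)
  show ?thesis
  proof (intro equalityI subsetI)
    fix X assume "X \<in> conj_products (Cs @ [C])"
    then obtain Ws W where "X = foldr (\<otimes>) (Ws @ [W]) \<one>" "list_all2 (\<lambda>W C. W \<in> conj_class C) Ws Cs"
      "W \<in> conj_class C"
      unfolding conj_products_def list_all2_append2 list_all2_Cons2 by auto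
    with * show "X \<in> {X \<otimes> W | X W. X \<in> conj_products Cs \<and> W \<in> conj_class C}"
      unfolding conj_products_def by blast
  next
    fix X assume "X \<in> {X \<otimes> W | X W. X \<in> conj_products Cs \<and> W \<in> conj_class C}"
    then obtain Ws W where Ws: "X = foldr (\<otimes>) Ws \<one> \<otimes> W"
      "list_all2 (\<lambda>W C. W \<in> conj_class C) Ws Cs" "W \<in> conj_class C"
      unfolding conj_products_def by blast
    moreover from Ws have "list_all2 (\<lambda>W C. W \<in> conj_class C) (Ws @ [W]) (Cs @ [C])"
      by (simp add: list_all2_appendI)
    ultimately show "X \<in> conj_products (Cs @ [C])"
      using *[of Ws W] unfolding conj_products_def by (metis (mono_tags, lifting) mem_Collect_eq)
  qed
qed

text \<open>The part \<open>A \<noteq> D \<longrightarrow> s = 2\<close> is the invariant that lets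
  \<open>summary_step\<close> compare the accumulated products instead of the diagonal of
  \<open>C\<close>.\<close>

lemma summary_correct:
  assumes "set Cs \<subseteq> carrier G" "foldl (summary_step p) (1, 1, 0) Cs = (A, D, s)"
  shows "A \<in> {1..<P} \<and> D \<in> {1..<P} \<and> (A \<noteq> D \<longrightarrow> s = 2) \<and>
    conj_products Cs = {tri A v D | v. v \<in> shape_set s}"
  using assms
proof (induction Cs arbitrary: A D s rule: rev_induct)
  case Nil
  then show ?case
    using P_gt_1 by (auto simp: conj_products_def one_G shape_set_def)
next
  case (snoc C Cs)
  obtain A0 D0 s0 where 0: "foldl (summary_step p) (1, 1, 0) Cs = (A0, D0, s0)"
    by (metis prod_cases3)
  with snoc have IH: "A0 \<in> {1..<P}" "D0 \<in> {1..<P}" "A0 \<noteq> D0 \<longrightarrow> s0 = 2"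
    "conj_products Cs = {tri A0 v D0 | v. v \<in> shape_set s0}"
    by auto
  obtain a b d where C: "C = tri a b d" "a \<in> {1..<P}" "b \<in> {0..<P}" "d \<in> {1..<P}"
    using snoc.prems by (auto simp: carrier_G)
  have ADs: "A = (A0 * a) mod P" "D = (D0 * d) mod P"
    "s = (if A = D then if b = 0 then s0 else add_unit_shape (odd p) s0 else 2)"
    using snoc.prems(2) 0 by (auto simp: summary_step_def C Let_def P_def)
  have ndvd: "coprime a P" "coprime A0 P"
    using C IH coprime_P by simp_all
  \<comment> \<open>The diagonal entries are units, so any two of the equalities
    \<open>A0 = D0\<close>, \<open>a = d\<close>, \<open>A = D\<close> imply the third.\<close>
  have 1: "a = d" if "A = D" "A0 = D0"
  proof -
    have "[A0 * a = A0 * d] (mod P)"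
      using that ADs by (simp add: cong_def)
    then show ?thesis
      using ndvd C by (auto simp: cong_mult_lcancel intro: eq_of_cong)
  qed
  have 2: "A0 = D0" if "A = D" "a = d"
  proof -
    have "[A0 * a = D0 * a] (mod P)"
      using that ADs by (simp add: cong_def)
    then show ?thesis
      using ndvd IH by (auto simp: cong_mult_rcancel intro: eq_of_cong)
  qed
  have 3: "A = D" if "A0 = D0" "a = d"
    using that ADs by simp
  define t where "t = (if a \<noteq> d then 2 else if b = 0 then 0 else 1 :: nat)"
  \<comment> \<open>If \<open>a = d\<close>, then \<open>A = D\<close> and \<open>A0 = D0\<close>
    are equivalent, and where they fail both shapes are \<open>2\<close>. If
    \<open>a \<noteq> d\<close>, then \<open>A = D\<close> forces \<open>A0 \<noteq> D0\<close>,
    hence \<open>s0 = 2\<close>, which absorbs.\<close>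
  have s: "s = add_shape (odd p) t s0"
  proof (cases "a = d")
    case True
    then show ?thesis
      using IH(3) 2 3 unfolding ADs(3) by (cases "A = D"; cases "A0 = D0")
          (simp_all add: t_def add_shape_def add_unit_shape_def)
  next
    case False
    then show ?thesis
      using IH(3) 1 unfolding ADs(3) by (cases "A = D"; cases "A0 = D0")
          (simp_all add: t_def add_shape_def add_unit_shape_def)
  qed
  have class_C: "conj_class C = {tri a w d | w. w \<in> shape_set t}"
    using C by (auto simp: conj_class_tri shape_set_def t_def)
  have "conj_products (Cs @ [C]) = {X \<otimes> W | X W. X \<in> conj_products Cs \<and> W \<in> conj_class C}"
    by (rule conj_products_snoc) (use snoc.prems in simp)
  also have "\<dots> = {tri A x D | x. x \<in> {(A0 * w + v * d) mod P | w v. w \<in> shape_set t \<and> v \<in> shape_set s0}}"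
    unfolding IH class_C
  proof (intro equalityI subsetI)
    fix X assume "X \<in> {X \<otimes> W | X W. X \<in> {tri A0 v D0 | v. v \<in> shape_set s0} \<and>
      W \<in> {tri a w d | w. w \<in> shape_set t}}"
    then obtain v w where "X = tri A0 v D0 \<otimes> tri a w d" "v \<in> shape_set s0" "w \<in> shape_set t"
      by blast
    then show "X \<in> {tri A x D | x. x \<in> {(A0 * w + v * d) mod P | w v. w \<in> shape_set t \<and> v \<in> shape_set s0}}"
      unfolding mult_tri ADs by blast
  next
    fix X assume "X \<in> {tri A x D | x. x \<in> {(A0 * w + v * d) mod P
        | w v. w \<in> shape_set t \<and> v \<in> shape_set s0}}"
    then obtain v w where "X = tri A0 v D0 \<otimes> tri a w d" "v \<in> shape_set s0" "w \<in> shape_set t"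
      unfolding mult_tri ADs by blast
    then show "X \<in> {X \<otimes> W | X W. X \<in> {tri A0 v D0 | v. v \<in> shape_set s0} \<and>
      W \<in> {tri a w d | w. w \<in> shape_set t}}"
      by blast
  qed
  also have "\<dots> = {tri A x D | x. x \<in> shape_set s}"
    using IH C by (simp only: lin_comb_shape s)
  finally show ?case
    using prod_nonzero[OF IH(1) C(2)] prod_nonzero[OF IH(2) C(4)] mod_P_range ADs
    by (auto simp: int_one_le_iff_zero_less)
qed

lemma conj_products_iff:
  "X \<in> conj_products Cs \<longleftrightarrow> (\<exists>Zs. length Zs = length Cs \<and> set Zs \<subseteq> carrier G \<and>
     foldr (\<otimes>) (map2 (\<lambda>Z C. inv Z \<otimes> C \<otimes> Z) Zs Cs) \<one> = X)"
proof -
  have "list_all2 (\<lambda>W C. W \<in> conj_class C) Ws Cs \<longleftrightarrow>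
     (\<exists>Zs. length Zs = length Cs \<and> set Zs \<subseteq> carrier G \<and> map2 (\<lambda>Z C. inv Z \<otimes> C \<otimes> Z) Zs Cs = Ws)" for Ws
  proof (induction Cs arbitrary: Ws)
    case (Cons C Cs)
    have ex_length_Cons: "(\<exists>Zs. length Zs = length (C # Cs) \<and> R Zs) \<longleftrightarrow>
        (\<exists>Z Zs. length Zs = length Cs \<and> R (Z # Zs))" for R :: "(int ^ 2 ^ 2) list \<Rightarrow> bool"
      by (auto simp: length_Suc_conv)
    have "list_all2 (\<lambda>W C. W \<in> conj_class C) Ws (C # Cs) \<longleftrightarrow>
        (\<exists>W Ws'. Ws = W # Ws' \<and> W \<in> conj_class C \<and> (\<exists>Zs. length Zs = length Cs \<and>
          set Zs \<subseteq> carrier G \<and> map2 (\<lambda>Z C. inv Z \<otimes> C \<otimes> Z) Zs Cs = Ws'))"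
      unfolding list_all2_Cons2 Cons ..
    also have "\<dots> \<longleftrightarrow> (\<exists>Z Zs. length Zs = length Cs \<and> Z \<in> carrier G \<and> set Zs \<subseteq> carrier G \<and>
          map2 (\<lambda>Z C. inv Z \<otimes> C \<otimes> Z) (Z # Zs) (C # Cs) = Ws)"
      by (auto simp: conj_class_def)
    also have "\<dots> \<longleftrightarrow> (\<exists>Zs. length Zs = length (C # Cs) \<and> set Zs \<subseteq> carrier G \<and>
          map2 (\<lambda>Z C. inv Z \<otimes> C \<otimes> Z) Zs (C # Cs) = Ws)"
      unfolding ex_length_Cons by simp
    finally show ?case .
  qed auto
  then show ?thesis
    by (auto simp: conj_products_def)
qed

theorem conj_product_eq_one_iff:
  assumes "set Cs \<subseteq> carrier G" "foldl (summary_step p) (1, 1, 0) Cs = (A, D, s)"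
  shows "(\<exists>Zs. length Zs = length Cs \<and> set Zs \<subseteq> carrier G \<and>
     foldr (\<otimes>) (map2 (\<lambda>Z C. inv Z \<otimes> C \<otimes> Z) Zs Cs) \<one> = \<one>) \<longleftrightarrow> A = 1 \<and> D = 1 \<and> s \<noteq> 1"
  unfolding conj_products_iff[symmetric] using summary_correct[OF assms] P_gt_1
  by (auto simp: one_G shape_set_def)

end

section \<open>Two-tape machines over an arbitrary finite alphabet\<close>

lemma funpow_trans: "(f ^^ (m + n)) x = z" if "(f ^^ m) x = y" "(f ^^ n) y = z"
  using that by (simp add: add.commute[of m] funpow_add)

definition list_tape :: "nat list \<Rightarrow> int \<Rightarrow> tape" where
  "list_tape w k = ((\<lambda>i. if 0 \<le> i \<and> i < int (length w) then w ! nat i else 0), k)"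

definition cell :: "'c list \<Rightarrow> int \<Rightarrow> 'c option" where
  "cell xs k = (if 0 \<le> k \<and> k < int (length xs) then Some (xs ! nat k) else None)"

lemma cell_length [simp]: "cell xs (int (length xs)) = None"
  by (simp add: cell_def)

lemma cell_minus_one [simp]: "cell xs (- 1) = None"
  by (simp add: cell_def)

lemma cell_append_Cons [simp]: "cell (xs @ y # ys) (int (length xs)) = Some y"
  by (simp add: cell_def)

lemma act_list_tape_same: "act (read_tape (list_tape w k), d) (list_tape w k) = list_tape w (shift d k)"
  by (auto simp: list_tape_def read_tape_def fun_eq_iff)

text \<open>A two-tape machine with a read-only input tape and a work tape over the alphabet \<open>'c\<close>, whose
  blank is \<open>None\<close>. Only the states in \<open>Q\<close> are used.\<close>

locale two_tape_machine =
  fixes \<delta> :: "'q::countable \<Rightarrow> nat \<Rightarrow> 'c::{countable, finite} option \<Rightarrow> 'q \<times> 'c option \<times> move \<times> move"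
    and Q :: "'q set" and q0 yes no :: 'q and s :: nat
  assumes finite_Q: "finite Q" and q0: "q0 \<in> Q" and yes: "yes \<in> Q" and no: "no \<in> Q"
    and yes_no: "yes \<noteq> no" and closed: "q \<in> Q \<Longrightarrow> fst (\<delta> q a x) \<in> Q"
begin

definition state_code :: "'q \<Rightarrow> nat" where
  "state_code q = (if q = q0 then 0 else Suc (to_nat q))"

definition sym_code :: "'c option \<Rightarrow> nat" where
  "sym_code x = (case x of None \<Rightarrow> 0 | Some c \<Rightarrow> Suc (to_nat c))"

text \<open>The number of symbols exceeds \<open>s\<close> and all codes of work symbols, so both
  tapes share one alphabet. Numbers below \<open>states\<close> that code no state of
  \<open>Q\<close> get a harmless default, since \<open>wf_tm\<close> quantifies over them
  too.\<close>

definition machine :: tm where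
  "machine =
    \<lparr>tapes = 2, symbols = s + 1 + Suc (Max (range sym_code)), states = Suc (Max (state_code ` Q)),
     acc = state_code yes, rej = state_code no,
     trans = \<lambda>n r. if n \<in> state_code ` Q
       then case \<delta> (inv_into UNIV state_code n) (r ! 0) (inv_into UNIV sym_code (r ! 1)) of
         (q, x, d, d') \<Rightarrow> (state_code q, [(r ! 0, d), (sym_code x, d')])
       else (0, [(0, Stay), (0, Stay)])\<rparr>"

definition conf :: "'q \<Rightarrow> nat list \<Rightarrow> int \<Rightarrow> 'c list \<Rightarrow> int \<Rightarrow> config" where
  "conf q w i xs k = (state_code q, [list_tape w i, list_tape (map (sym_code \<circ> Some) xs) k])"

lemma inj_state_code: "inj state_code"
  by (auto simp: inj_def state_code_def)

lemma inj_sym_code: "inj sym_code"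
  by (auto simp: inj_def sym_code_def split: option.splits)

lemma state_code_less: "q \<in> Q \<Longrightarrow> state_code q < states machine"
  using finite_Q by (simp add: machine_def less_Suc_eq_le)

lemma sym_code_less: "sym_code x < symbols machine"
  by (simp add: machine_def less_Suc_eq_le trans_le_add2 le_SucI)

lemma wf_machine: "wf_tm machine"
proof -
  have "fst (trans machine n r) < states machine \<and> length (snd (trans machine n r)) = tapes machine \<and>
      (\<forall>(a, d) \<in> set (snd (trans machine n r)). a < symbols machine)"
    if r: "r \<in> lists {..<symbols machine}" "length r = tapes machine" for n r
  proof (cases "n \<in> state_code ` Q")
    case False
    then show ?thesis
      by (simp add: machine_def)
  next
    case True
    then obtain q where q: "q \<in> Q" "n = state_code q"
      by blast
    obtain q' x d d' where \<delta>: "\<delta> q (r ! 0) (inv_into UNIV sym_code (r ! 1)) = (q', x, d, d')"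
      by (metis prod_cases4)
    then have "trans machine n r = (state_code q', [(r ! 0, d), (sym_code x, d')])"
      using True by (simp add: machine_def q inv_f_f inj_state_code)
    moreover have "r ! 0 < symbols machine"
      using r by (auto simp: in_lists_conv_set machine_def)
    moreover have "q' \<in> Q"
      using closed[OF q(1)] \<delta> by (metis fst_conv)
    ultimately show ?thesis
      by (simp add: state_code_less sym_code_less) (simp add: machine_def)
  qed
  moreover have "acc machine \<noteq> rej machine"
    using yes_no inj_state_code by (simp add: machine_def inj_eq)
  moreover have "0 < states machine" "0 < symbols machine" "0 < tapes machine"
    by (simp_all add: machine_def)
  moreover have "acc machine < states machine" "rej machine < states machine"
    using state_code_less[OF yes] state_code_less[OF no] by (simp_all add: machine_def)
  ultimately show ?thesis
    unfolding wf_tm_def by blast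
qed

lemma read_work_tape: "read_tape (list_tape (map (sym_code \<circ> Some) xs) k) = sym_code (cell xs k)"
  by (auto simp: read_tape_def list_tape_def cell_def sym_code_def)

lemma step_conf:
  assumes "q \<in> Q" "q \<noteq> yes" "q \<noteq> no"
    and \<delta>: "\<delta> q (read_tape (list_tape w i)) (cell xs k) = (q', x, d, d')"
  shows "step machine (conf q w i xs k) =
    (state_code q', [list_tape w (shift d i), act (sym_code x, d')
        (list_tape (map (sym_code \<circ> Some) xs) k)])"
proof -
  have "\<not> halted machine (conf q w i xs k)"
    using assms(2,3) inj_state_code by (simp add: halted_def conf_def machine_def inj_eq)
  then show ?thesis
    using assms(1) \<delta>
    by (simp add: step_def conf_def read_work_tape act_list_tape_same)
      (simp add: machine_def inv_f_f inj_state_code inj_sym_code act_list_tape_same)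
qed

text \<open>This and the next two lemmas cover a blank left blank at either end of the word, a cell
  overwritten in place, and a cell appended at the right end.\<close>

lemma step_None:
  assumes "q \<in> Q" "q \<noteq> yes" "q \<noteq> no" "cell xs k = None"
    and "\<delta> q (read_tape (list_tape w i)) None = (q', None, d, d')"
  shows "step machine (conf q w i xs k) = conf q' w (shift d i) xs (shift d' k)"
  using step_conf[OF assms(1-3), where xs = xs and k = k] assms(4,5)
  by (auto simp: conf_def list_tape_def sym_code_def cell_def fun_eq_iff split: if_splits)

lemma step_Some:
  assumes "q \<in> Q" "q \<noteq> yes" "q \<noteq> no"
    and "\<delta> q (read_tape (list_tape w i)) (Some c) = (q', Some c', d, d')"
  shows "step machine (conf q w i (xs @ c # ys) (int (length xs))) =
    conf q' w (shift d i) (xs @ c' # ys) (shift d' (int (length xs)))"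
  using step_conf[OF assms(1-3), where xs = "xs @ c # ys" and k = "int (length xs)"] assms(4)
  by (auto simp: conf_def list_tape_def sym_code_def fun_eq_iff nth_append nth_Cons split: if_splits nat.splits)

lemma step_snoc:
  assumes "q \<in> Q" "q \<noteq> yes" "q \<noteq> no"
    and "\<delta> q (read_tape (list_tape w i)) None = (q', Some c, d, d')"
  shows "step machine (conf q w i xs (int (length xs))) =
    conf q' w (shift d i) (xs @ [c]) (shift d' (int (length xs)))"
  using step_conf[OF assms(1-3), where xs = xs and k = "int (length xs)"] assms(4)
  by (auto simp: conf_def list_tape_def sym_code_def fun_eq_iff nth_append split: if_splits)

lemma init_conf: "init_config machine w = conf q0 w 0 [] 0"
  by (simp add: init_config_def conf_def machine_def state_code_def list_tape_def input_tape_def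
      blank_tape_def numeral_2_eq_2 fun_eq_iff)

lemma language_in_class_P:
  fixes f :: "nat poly"
  assumes "\<And>w. w \<in> lists {1..s} \<Longrightarrow>
    \<exists>t \<le> poly f (length w). \<exists>i xs k. (step machine ^^ t) (conf q0 w 0 [] 0) =
        conf (if w \<in> L then yes else no) w i xs k"
    and "L \<subseteq> lists {1..s}"
  shows "L \<in> class_P s"
proof -
  have "decides_in_time machine s L (poly f)"
    unfolding decides_in_time_def run_def init_conf
  proof
    fix w assume "w \<in> lists {1..s}"
    from assms(1)[OF this] obtain t i xs k where "t \<le> poly f (length w)"
      "(step machine ^^ t) (conf q0 w 0 [] 0) = conf (if w \<in> L then yes else no) w i xs k"
      by blast
    then show "\<exists>t \<le> poly f (length w). fst ((step machine ^^ t) (conf q0 w 0 [] 0)) =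
        (if w \<in> L then acc machine else rej machine)"
      by (intro exI[of _ t]) (simp add: conf_def machine_def)
  qed
  moreover have "s < symbols machine"
    by (simp add: machine_def)
  ultimately show ?thesis
    using wf_machine assms(2) unfolding class_P_def by blast
qed

end

section \<open>The sweeping machine\<close>

text \<open>
  A column holds one bit of each of the modulus \<open>P\<close>, the diagonal products \<open>A\<close> and \<open>D\<close>, the accumulator
  \<open>R\<close>, a mark of the least significant position, and the candidates \<open>2R + Y - jP\<close> for \<open>j = 0, 1, 2\<close>.
\<close>

datatype col = Col (p_bit: bool) (a_bit: bool) (d_bit: bool) (r_bit: bool) (lsb_mark: bool)
  (u0_bit: bool) (u1_bit: bool) (u2_bit: bool)

instance col :: countable
  by countable_datatype

instance col :: finite
proof
  have "UNIV \<subseteq> (\<lambda>(a, b, c, d, e, f, g, h). Col a b c d e f g h) ` UNIV"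
  proof
    fix x show "x \<in> (\<lambda>(a, b, c, d, e, f, g, h). Col a b c d e f g h) ` UNIV"
      by (cases x) (auto simp: image_iff)
  qed
  then show "finite (UNIV :: col set)"
    by (rule finite_subset) simp
qed

text \<open>
  A control state consists of the index of the current matrix entry (4 before the first matrix),
  whether this entry has shown a nonzero digit, the shape of the upper right entries, and the
  parity of \<open>p\<close>. A sweep from the least significant column collects whether it is still at its first
  column, whether \<open>A = R\<close> and \<open>R = 1\<close> so far, and the three carries.
\<close>

type_synonym ctrl = "nat \<times> bool \<times> nat \<times> bool"
type_synonym sweep_acc = "bool \<times> bool \<times> bool \<times> int \<times> int \<times> int"

text \<open>One column of the serial computation of \<open>2R + Y - jP\<close>: the parity of the
  column sum is the new digit, and half of it, rounded down, is the carry, which is negative in case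
  of a borrow.\<close>

definition lin :: "int \<Rightarrow> bool \<Rightarrow> bool \<Rightarrow> bool \<Rightarrow> int \<Rightarrow> int" where
  "lin j p r y c = 2 * of_bool r + of_bool y - j * of_bool p + c"

text \<open>\<open>b\<close> tells whether the digit just read is a binary \<open>1\<close>; only
  then is \<open>A\<close> or \<open>D\<close> added. The flag \<open>r_one\<close> survives iff
  \<open>R\<close> has its only \<open>1\<close> in the first column.\<close>

fun scan_col :: "nat \<Rightarrow> bool \<Rightarrow> sweep_acc \<Rightarrow> col \<Rightarrow> sweep_acc \<times> col" where
  "scan_col e b (first, same, r_one, c0, c1, c2) (Col p a d r mk u0 u1 u2) =
    (let y = (b \<and> (if e = 0 then a else d));
         t0 = lin 0 p r y c0; t1 = lin 1 p r y c1; t2 = lin 2 p r y c2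
     in ((False, same \<and> (a \<longleftrightarrow> r), r_one \<and> (r \<longleftrightarrow> first), t0 div 2, t1 div 2, t2 div 2),
         Col p a d r first (odd t0) (odd t1) (odd t2)))"

fun scan :: "nat \<Rightarrow> bool \<Rightarrow> sweep_acc \<Rightarrow> col list \<Rightarrow> sweep_acc \<times> col list" where
  "scan e b s [] = (s, [])"
| "scan e b s (x # xs) =
    (let (s', x') = scan_col e b s x; (s'', xs') = scan e b s' xs in (s'', x' # xs'))"

text \<open>The choice among the candidates depends on the final carries, so it is made on the way
  back. At a separator \<open>R\<close> moves to \<open>A\<close> or \<open>D\<close>; before the
  first matrix both become \<open>1\<close> by means of the mark.\<close>

fun update_col :: "nat \<Rightarrow> nat \<Rightarrow> sweep_acc \<Rightarrow> col \<Rightarrow> col" where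
  "update_col e inp (first, same, r_one, c0, c1, c2) (Col p a d r mk u0 u1 u2) =
    (if inp = 3 then
       if e = 4 then Col p mk mk False mk u0 u1 u2
       else if e = 0 then Col p r d False mk u0 u1 u2
       else if e = 3 then Col p a r False mk u0 u1 u2
       else Col p a d r mk u0 u1 u2
     else if e = 0 \<or> e = 3 then
       Col p a d (if 0 \<le> c2 then u2 else if 0 \<le> c1 then u1 else u0) mk u0 u1 u2
     else Col p a d r mk u0 u1 u2)"

text \<open>A separator closes entry \<open>e\<close>. At \<open>e = 1\<close> the flag
  \<open>z\<close> tells whether the upper right entry is nonzero; at \<open>e = 3\<close> the
  accumulator holds the new \<open>D\<close>, so \<open>same\<close> compares it with the new
  \<open>A\<close>.\<close>

fun next_ctrl :: "ctrl \<Rightarrow> nat \<Rightarrow> sweep_acc \<Rightarrow> ctrl" where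
  "next_ctrl (e, z, s, odd_p) inp (first, same, r_one, c0, c1, c2) =
    (if inp = 3 then
       (if e \<ge> 3 then 0 else e + 1, False,
        if e = 1 \<and> z then add_unit_shape odd_p s else if e = 3 \<and> \<not> same then 2 else s, odd_p)
     else (e, z \<or> inp = 2, s, odd_p))"

text \<open>No separator follows the last entry, so the final \<open>D\<close> is still in
  \<open>R\<close> and the test is \<open>A = R = 1\<close>. If \<open>A = R\<close>, the shape in
  the control is already final.\<close>

fun accepts :: "ctrl \<Rightarrow> sweep_acc \<Rightarrow> bool" where
  "accepts (e, z, s, odd_p) (first, same, r_one, c0, c1, c2) \<longleftrightarrow> same \<and> r_one \<and> s \<noteq> 1"

definition init_acc :: sweep_acc where
  "init_acc = (True, True, True, 0, 0, 0)"

definition sweep :: "ctrl \<Rightarrow> nat \<Rightarrow> col list \<Rightarrow> ctrl \<times> col list" where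
  "sweep g inp xs =
    (let (s, xs') = scan (fst g) (inp = 2) init_acc xs
     in (next_ctrl g inp s, map (update_col (fst g) inp s) xs'))"

fun process :: "ctrl \<Rightarrow> col list \<Rightarrow> nat list \<Rightarrow> bool" where
  "process g xs [] = accepts g (fst (scan (fst g) False init_acc xs))"
| "process g xs (inp # w) = (let (g', xs') = sweep g inp xs in process g' xs' w)"

definition digit_col :: "bool \<Rightarrow> col" where
  "digit_col b = Col b False False False False False False False"

text \<open>Digits are pushed onto the list, so the least significant column comes first, and the
  last digit read gives the parity. The first separator is not consumed here but handed on to
  \<open>process\<close>, whose first sweep initialises the registers.\<close>

fun read_prime :: "bool \<Rightarrow> col list \<Rightarrow> nat list \<Rightarrow> bool" where
  "read_prime odd_p xs [] = True"
| "read_prime odd_p xs (inp # w) =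
    (if inp = 3 then process (4, False, 0, odd_p) xs (inp # w)
     else read_prime (inp = 2) (digit_col (inp = 2) # xs) w)"

section \<open>The transition function and its running time\<close>

datatype mstate = Read bool | Scan ctrl sweep_acc | Back ctrl sweep_acc | Yes | No

instance mstate :: countable
  by countable_datatype

definition ctrls :: "ctrl set" where
  "ctrls = {..4} \<times> UNIV \<times> {..2} \<times> UNIV"

definition sweep_accs :: "sweep_acc set" where
  "sweep_accs = UNIV \<times> UNIV \<times> UNIV \<times> {-2..2} \<times> {-2..2} \<times> {-2..2}"

definition mstates :: "mstate set" where
  "mstates = range Read \<union> case_prod Scan ` (ctrls \<times> sweep_accs) \<union>
    case_prod Back ` (ctrls \<times> sweep_accs) \<union> {Yes, No}"

lemma funpow_one: "(f ^^ 1) x = f x" for f :: "'a \<Rightarrow> 'a"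
  by simp

lemma mem_mstates [simp]:
  "Read odd_p \<in> mstates" "Scan g s \<in> mstates \<longleftrightarrow> g \<in> ctrls \<and> s \<in> sweep_accs"
  "Back g s \<in> mstates \<longleftrightarrow> g \<in> ctrls \<and> s \<in> sweep_accs" "Yes \<in> mstates" "No \<in> mstates"
  by (auto simp: mstates_def)

lemma init_acc_mem [simp]: "init_acc \<in> sweep_accs"
  by (simp add: init_acc_def sweep_accs_def)

text \<open>The column sum lies between \<open>-4\<close> and \<open>5\<close>, so halving keeps the
  carries in \<open>{-2..2}\<close>. Hence finitely many states suffice.\<close>

lemma lin_div_2_bounds: "lin j p r y c div 2 \<in> {-2..2}" if "j \<in> {0..2}" "c \<in> {-2..2}"
  using that by (auto simp: lin_def of_bool_def)

lemma scan_col_mem: "fst (scan_col e b s x) \<in> sweep_accs" if "s \<in> sweep_accs"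
  using that lin_div_2_bounds[of 0] lin_div_2_bounds[of 1] lin_div_2_bounds[of 2]
  by (cases "(e, b, s, x)" rule: scan_col.cases) (simp add: sweep_accs_def Let_def)

lemma add_unit_shape_le: "add_unit_shape odd_p s \<le> 2"
  by (simp add: add_unit_shape_def)

lemma init_ctrl_mem [simp]: "(4, False, 0, odd_p) \<in> ctrls"
  by (simp add: ctrls_def)

lemma next_ctrl_mem: "next_ctrl g inp s \<in> ctrls" if "g \<in> ctrls"
  using that by (cases "(g, inp, s)" rule: next_ctrl.cases) (auto simp: ctrls_def add_unit_shape_le)

text \<open>The most significant column is at position \<open>0\<close>. A scan runs left from the
  last column to the blank at \<open>-1\<close>, the way back runs right to the blank after the last
  column, and there the input head advances.\<close>

fun \<delta> :: "mstate \<Rightarrow> nat \<Rightarrow> col option \<Rightarrow> mstate \<times> col option \<times> move \<times> move" where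
  "\<delta> (Read odd_p) inp x =
    (if inp = 0 then (Yes, None, Stay, Stay)
     else if inp = 3 then (Scan (4, False, 0, odd_p) init_acc, None, Stay, Left)
     else (Read (inp = 2), Some (digit_col (inp = 2)), Right, Right))"
| "\<delta> (Scan g s) inp None = (Back g s, None, Stay, Right)"
| "\<delta> (Scan g s) inp (Some c) =
    (let (s', c') = scan_col (fst g) (inp = 2) s c in (Scan g s', Some c', Stay, Left))"
| "\<delta> (Back g s) inp None =
    (if inp = 0 then (if accepts g s then Yes else No, None, Stay, Stay)
     else (Scan (next_ctrl g inp s) init_acc, None, Right, Left))"
| "\<delta> (Back g s) inp (Some c) = (Back g s, Some (update_col (fst g) inp s c), Stay, Right)"
| "\<delta> Yes inp x = (Yes, None, Stay, Stay)"
| "\<delta> No inp x = (No, None, Stay, Stay)"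

interpretation tm: two_tape_machine \<delta> mstates "Read False" Yes No 3
proof
  show "finite mstates"
    by (simp add: mstates_def ctrls_def sweep_accs_def)
next
  fix q a x assume "q \<in> mstates"
  then show "fst (\<delta> q a x) \<in> mstates"
    using scan_col_mem[of _ "fst _" "a = 2"]
    by (cases "(q, a, x)" rule: \<delta>.cases) (auto simp: next_ctrl_mem split: prod.split, metis fst_conv)
qed simp_all

lemma read_list_tape_nth: "read_tape (list_tape (u @ v) (int (length u))) = (case v of [] \<Rightarrow> 0 | a # _ \<Rightarrow> a)"
  by (auto simp: list_tape_def read_tape_def nth_append split: list.split)

text \<open>\<open>rev xs\<close> remains to be scanned, \<open>ys\<close> is already rewritten. The
  reversal reconciles \<open>scan\<close>, which starts with the least significant column, with the
  order on the tape.\<close>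

lemma run_scan:
  assumes "g \<in> ctrls" "s \<in> sweep_accs" "read_tape (list_tape w i) = inp"
    "scan (fst g) (inp = 2) s xs = (s', xs')"
  shows "s' \<in> sweep_accs \<and> (step tm.machine ^^ length xs) (tm.conf (Scan g s) w i (rev xs @ ys)
      (int (length xs) - 1)) =
    tm.conf (Scan g s') w i (rev xs' @ ys) (- 1)"
  using assms
proof (induction xs arbitrary: s xs' ys)
  case (Cons x xs)
  obtain s1 x' where 1: "scan_col (fst g) (inp = 2) s x = (s1, x')"
    by fastforce
  obtain xs1 where 2: "scan (fst g) (inp = 2) s1 xs = (s', xs1)" "xs' = x' # xs1"
    using Cons.prems(4) 1 by (auto split: prod.splits)
  have s1: "s1 \<in> sweep_accs"
    using scan_col_mem[OF Cons.prems(2)] 1 by (metis fst_conv)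
  have "step tm.machine (tm.conf (Scan g s) w i (rev xs @ x # ys) (int (length (rev xs)))) =
      tm.conf (Scan g s1) w (shift Stay i) (rev xs @ x' # ys) (shift Left (int (length (rev xs))))"
    by (rule tm.step_Some) (use Cons.prems 1 in auto)
  then show ?case
    using Cons.IH[OF Cons.prems(1) s1 Cons.prems(3) 2(1), of "x' # ys"]
    by (simp add: funpow_swap1 2(2) del: funpow.simps) (simp add: funpow_swap1)
qed simp

lemma run_back:
  assumes "g \<in> ctrls" "s \<in> sweep_accs" "read_tape (list_tape w i) = inp"
  shows "(step tm.machine ^^ length ys) (tm.conf (Back g s) w i (zs @ ys) (int (length zs))) =
    tm.conf (Back g s) w i (zs @ map (update_col (fst g) inp s) ys) (int (length zs + length ys))"
  using assms
proof (induction ys arbitrary: zs)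
  case (Cons y ys)
  have "step tm.machine (tm.conf (Back g s) w i (zs @ y # ys) (int (length zs))) =
      tm.conf (Back g s) w (shift Stay i) (zs @ update_col (fst g) inp s y # ys) (shift Right
          (int (length zs)))"
    by (rule tm.step_Some) (use Cons.prems in auto)
  then show ?case
    using Cons.IH[OF Cons.prems, of "zs @ [update_col (fst g) inp s y]"]
    by (simp add: funpow_swap1 add.commute)
qed simp

lemma length_scan: "scan e b s xs = (s', xs') \<Longrightarrow> length xs' = length xs"
  by (induction xs arbitrary: s xs') (auto split: prod.splits)

lemma run_scan_back:
  assumes "g \<in> ctrls" "read_tape (list_tape w i) = inp" "scan (fst g) (inp = 2) init_acc xs = (s, xs')"
  shows "(step tm.machine ^^ (2 * length xs + 1)) (tm.conf (Scan g init_acc) w i (rev xs)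
      (int (length xs) - 1)) =
    tm.conf (Back g s) w i (rev (map (update_col (fst g) inp s) xs')) (int (length xs))"
proof -
  have s: "s \<in> sweep_accs" and
    1: "(step tm.machine ^^ length xs) (tm.conf (Scan g init_acc) w i (rev xs) (int (length xs) - 1)) =
      tm.conf (Scan g s) w i (rev xs') (- 1)"
    using run_scan[OF assms(1) init_acc_mem assms(2,3), of "[]"] by simp_all
  have 2: "(step tm.machine ^^ 1) (tm.conf (Scan g s) w i (rev xs') (- 1)) =
      tm.conf (Back g s) w (shift Stay i) (rev xs') (shift Right (- 1))"
    unfolding funpow_one by (rule tm.step_None) (use assms(1) s in auto)
  have 3: "(step tm.machine ^^ length (rev xs')) (tm.conf (Back g s) w i ([] @ rev xs')
      (int (length ([] :: col list)))) =
      tm.conf (Back g s) w i ([] @ map (update_col (fst g) inp s) (rev xs'))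
          (int (length ([] :: col list) + length (rev xs')))"
    by (rule run_back[OF assms(1) s assms(2)])
  show ?thesis
    using funpow_trans[OF funpow_trans[OF 1 2], of "length (rev xs')"] 3 length_scan[OF assms(3)]
    by (simp add: rev_map flip: mult_2)
qed

text \<open>Each input symbol costs a sweep of \<open>2 * length xs + 1\<close> steps and one step
  at the right blank. The end of the input costs as much again, hence
  \<open>length v + 1\<close>.\<close>

lemma run_process:
  assumes "g \<in> ctrls" "v \<in> lists {1..3}"
  shows "\<exists>i ys k. (step tm.machine ^^ ((length v + 1) * (2 * length xs + 2)))
      (tm.conf (Scan g init_acc) (u @ v) (int (length u)) (rev xs) (int (length xs) - 1)) =
    tm.conf (if process g xs v then Yes else No) (u @ v) i ys k"
  using assms
proof (induction v arbitrary: g xs u)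
  case Nil
  obtain s xs' where s: "scan (fst g) False init_acc xs = (s, xs')"
    by fastforce
  have mem: "s \<in> sweep_accs"
    using run_scan[OF Nil(1) init_acc_mem, of u "int (length u)" 0 xs s xs' "[]"]
        s read_list_tape_nth[of u "[]"]
    by simp
  have 1: "(step tm.machine ^^ (2 * length xs + 1)) (tm.conf (Scan g init_acc) (u @ [])
      (int (length u)) (rev xs) (int (length xs) - 1)) =
    tm.conf (Back g s) (u @ []) (int (length u)) (rev (map (update_col (fst g) 0 s) xs')) (int (length xs))"
    by (rule run_scan_back) (use Nil s in \<open>simp_all add: read_list_tape_nth del: append_Nil2\<close>)
  let ?ys = "rev (map (update_col (fst g) 0 s) xs')"
  have len: "length ?ys = length xs"
    using length_scan[OF s] by simp
  have 2: "(step tm.machine ^^ 1) (tm.conf (Back g s) (u @ []) (int (length u)) ?ys (int (length xs))) =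
     tm.conf (if accepts g s then Yes else No) (u @ []) (shift Stay (int (length u))) ?ys (shift Stay
         (int (length xs)))"
    unfolding funpow_one by (rule tm.step_None)
      (use Nil mem len cell_length[of ?ys] in \<open>simp_all add: read_list_tape_nth del: append_Nil2 cell_length\<close>)
  show ?case
    using funpow_trans[OF 1 2] s by (intro exI) simp
next
  case (Cons inp v)
  obtain s xs' where s: "scan (fst g) (inp = 2) init_acc xs = (s, xs')"
    by fastforce
  have mem: "s \<in> sweep_accs"
    using run_scan[OF Cons.prems(1) init_acc_mem, of "u @ inp # v" "int (length u)" inp xs s xs' "[]"] s
      read_list_tape_nth[of u "inp # v"] by simp
  let ?ys = "map (update_col (fst g) inp s) xs'"
  have 1: "(step tm.machine ^^ (2 * length xs + 1)) (tm.conf (Scan g init_acc) (u @ inp # v)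
      (int (length u)) (rev xs) (int (length xs) - 1)) =
    tm.conf (Back g s) (u @ inp # v) (int (length u)) (rev ?ys) (int (length xs))"
    by (rule run_scan_back) (use Cons.prems s in \<open>simp_all add: read_list_tape_nth\<close>)
  have len: "length ?ys = length xs"
    using length_scan[OF s] by simp
  have 2: "(step tm.machine ^^ 1) (tm.conf (Back g s) (u @ inp # v) (int (length u)) (rev ?ys)
      (int (length xs))) =
     tm.conf (Scan (next_ctrl g inp s) init_acc) (u @ inp # v) (shift Right (int (length u))) (rev ?ys)
         (shift Left (int (length xs)))"
    unfolding funpow_one by (rule tm.step_None)
      (use Cons.prems mem len cell_length[of "rev ?ys"] in
          \<open>simp_all add: read_list_tape_nth del: cell_length\<close>)
  obtain i ys k where 3: "(step tm.machine ^^ ((length v + 1) * (2 * length ?ys + 2)))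
      (tm.conf (Scan (next_ctrl g inp s) init_acc) ((u @ [inp]) @ v) (int (length (u @ [inp])))
          (rev ?ys) (int (length ?ys) - 1)) =
    tm.conf (if process (next_ctrl g inp s) ?ys v then Yes else No) ((u @ [inp]) @ v) i ys k"
    using Cons.IH[of "next_ctrl g inp s" ?ys "u @ [inp]"] Cons.prems next_ctrl_mem by auto
  have "(step tm.machine ^^ (2 * length xs + 1 + 1 + (length v + 1) * (2 * length ?ys + 2)))
      (tm.conf (Scan g init_acc) (u @ inp # v) (int (length u)) (rev xs) (int (length xs) - 1)) =
    tm.conf (if process (next_ctrl g inp s) ?ys v then Yes else No) ((u @ [inp]) @ v) i ys k"
    by (rule funpow_trans[OF funpow_trans[OF 1 2]]) (use 3 in \<open>simp add: len add.commute del: length_map\<close>)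
  then show ?case
    using s len by (intro exI[of _ i] exI[of _ ys] exI[of _ k]) (simp add: sweep_def Let_def algebra_simps)
qed

lemma run_read_prime:
  assumes "v \<in> lists {1..3}"
  shows "\<exists>t \<le> length v + 1 + (length v + 1) * (2 * (length xs + length v) + 2). \<exists>i ys k.
    (step tm.machine ^^ t) (tm.conf (Read odd_p) (u @ v) (int (length u)) (rev xs) (int (length xs))) =
    tm.conf (if read_prime odd_p xs v then Yes else No) (u @ v) i ys k"
  using assms
proof (induction v arbitrary: odd_p xs u rule: list.induct)
  case Nil
  have "step tm.machine (tm.conf (Read odd_p) (u @ []) (int (length u)) (rev xs) (int (length xs))) =
     tm.conf Yes (u @ []) (shift Stay (int (length u))) (rev xs) (shift Stay (int (length xs)))"
    by (rule tm.step_None)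
      (use cell_length[of "rev xs"] in \<open>simp_all add: read_list_tape_nth del: append_Nil2 cell_length\<close>)
  then show ?case
    by (intro exI[of _ 1]) auto
next
  case (Cons inp v)
  show ?case
  proof (cases "inp = 3")
    case True
    have 1: "(step tm.machine ^^ 1) (tm.conf (Read odd_p) (u @ inp # v) (int (length u)) (rev xs)
        (int (length xs))) =
       tm.conf (Scan (4, False, 0, odd_p) init_acc) (u @ inp # v) (shift Stay (int (length u)))
           (rev xs) (shift Left (int (length xs)))"
      unfolding funpow_one by (rule tm.step_None)
        (use True cell_length[of "rev xs"] in \<open>simp_all add: read_list_tape_nth del: cell_length\<close>)
    obtain i ys k where 2: "(step tm.machine ^^ ((length (inp # v) + 1) * (2 * length xs + 2)))
      (tm.conf (Scan (4, False, 0, odd_p) init_acc) (u @ inp # v) (int (length u)) (rev xs)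
          (int (length xs) - 1)) =
      tm.conf (if process (4, False, 0, odd_p) xs (inp # v) then Yes else No) (u @ inp # v) i ys k"
      using run_process[OF init_ctrl_mem Cons.prems] by blast
    have "(step tm.machine ^^ (1 + (length (inp # v) + 1) * (2 * length xs + 2)))
      (tm.conf (Read odd_p) (u @ inp # v) (int (length u)) (rev xs) (int (length xs))) =
      tm.conf (if process (4, False, 0, odd_p) xs (inp # v) then Yes else No) (u @ inp # v) i ys k"
      by (rule funpow_trans[OF 1]) (use 2 in simp)
    moreover have "1 + (length (inp # v) + 1) * (2 * length xs + 2) \<le>
      length (inp # v) + 1 + (length (inp # v) + 1) * (2 * (length xs + length (inp # v)) + 2)"
      by (intro add_mono mult_le_mono) simp_all
    ultimately show ?thesis
      using True by (intro exI[of _ "1 + (length (inp # v) + 1) * (2 * length xs + 2)"] conjI exI) simp_all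
  next
    case False
    then have inp: "inp \<noteq> 0" "inp \<noteq> 3"
      using Cons.prems by auto
    let ?c = "digit_col (inp = 2)"
    have 1: "(step tm.machine ^^ 1) (tm.conf (Read odd_p) (u @ inp # v) (int (length u)) (rev xs)
        (int (length (rev xs)))) =
       tm.conf (Read (inp = 2)) (u @ inp # v) (shift Right (int (length u))) (rev xs @ [?c])
           (shift Right (int (length (rev xs))))"
      unfolding funpow_one by (rule tm.step_snoc) (use inp in \<open>simp_all add: read_list_tape_nth\<close>)
    obtain t i ys k where
      t: "t \<le> length v + 1 + (length v + 1) * (2 * (length (?c # xs) + length v) + 2)" and
      2: "(step tm.machine ^^ t) (tm.conf (Read (inp = 2)) ((u @ [inp]) @ v) (int (length (u @ [inp])))
          (rev (?c # xs)) (int (length (?c # xs)))) =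
       tm.conf (if read_prime (inp = 2) (?c # xs) v then Yes else No) ((u @ [inp]) @ v) i ys k"
      using Cons.IH[of "?c # xs" "inp = 2" "u @ [inp]"] Cons.prems by auto
    have "(step tm.machine ^^ (1 + t)) (tm.conf (Read odd_p) (u @ inp # v) (int (length u)) (rev xs)
        (int (length (rev xs)))) =
      tm.conf (if read_prime (inp = 2) (?c # xs) v then Yes else No) ((u @ [inp]) @ v) i ys k"
      by (rule funpow_trans[OF 1]) (use 2 in \<open>simp add: add.commute\<close>)
    moreover have "1 + t \<le> length (inp # v) + 1 + (length (inp # v) + 1) * (2 * (length xs +
        length (inp # v)) + 2)"
      using t by (simp add: algebra_simps)
    ultimately show ?thesis
      using inp by (intro exI[of _ "1 + t"] conjI exI) simp_all
  qed
qed

lemma read_prime_in_class_P: "{w \<in> lists {1..3}. read_prime False [] w} \<in> class_P 3"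
\<comment> \<open>With \<open>n\<close> the input length,
  \<open>2n^2 + 5n + 3 = (n + 1) + (n + 1)(2n + 2)\<close> is the bound of
  \<open>run_read_prime\<close> for an empty work tape.\<close>
proof (rule tm.language_in_class_P[where f = "[:3, 5, 2:]"])
  fix w :: "nat list"
  assume w: "w \<in> lists {1..3}"
  have poly_eq: "poly [:3, 5, 2:] (length w) =
      length w + 1 + (length w + 1) * (2 * (length ([] :: col list) + length w) + 2)"
    by (simp add: algebra_simps)
  have "w \<in> {w \<in> lists {1..3}. read_prime False [] w} \<longleftrightarrow> read_prime False [] w"
    using w by simp
  then show "\<exists>t \<le> poly [:3, 5, 2:] (length w). \<exists>i xs k. (step tm.machine ^^ t)
      (tm.conf (Read False) w 0 [] 0) =
      tm.conf (if w \<in> {w \<in> lists {1..3}. read_prime False [] w} then Yes else No) w i xs k"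
    using run_read_prime[OF w, of "[]" False "[]"] unfolding poly_eq by simp
qed blast

section \<open>Correctness of the machine\<close>

fun bin_val :: "bool list \<Rightarrow> int" where
  "bin_val [] = 0"
| "bin_val (b # bs) = of_bool b + 2 * bin_val bs"

lemma bin_val_bounds: "0 \<le> bin_val bs" "bin_val bs < 2 ^ length bs"
proof -
  have "0 \<le> bin_val bs \<and> bin_val bs < 2 ^ length bs"
    by (induction bs) auto
  then show "0 \<le> bin_val bs" "bin_val bs < 2 ^ length bs"
    by auto
qed

lemma of_bool_plus_double_eq_iff: "of_bool b + 2 * m = of_bool c + 2 * n \<longleftrightarrow> b = c \<and> m = n" for m n :: int
  by (cases b; cases c) (simp_all, presburger+)

text \<open>All registers have the same number of columns, so equality of numbers can be tested bit
  by bit; this justifies the flag \<open>same\<close>.\<close>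

lemma bin_val_eq_iff: "bin_val bs = bin_val cs \<longleftrightarrow> bs = cs" if "length bs = length cs"
  using that by (induction bs cs rule: list_induct2) (simp_all add: of_bool_plus_double_eq_iff)

definition regs :: "col list \<Rightarrow> int \<times> int \<times> int \<times> int" where
  "regs xs = (bin_val (map p_bit xs), bin_val (map a_bit xs), bin_val (map d_bit xs), bin_val (map r_bit xs))"

lemma lin_decomp: "of_bool (odd (lin j p r y c)) + 2 * (lin j p r y c div 2) = lin j p r y c"
  by (simp add: of_bool_odd_eq_mod_2)

text \<open>The digits produced together with the outgoing carry represent the exact integer, also
  when a difference is negative. The incoming accumulator is arbitrary to make the induction
  work.\<close>

lemma scan_correct:
  assumes "scan e b (first, same, r_one, c0, c1, c2) xs = ((first', same', r_one', c0', c1', c2'), xs')"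
  shows "map p_bit xs' = map p_bit xs \<and> map a_bit xs' = map a_bit xs \<and> map d_bit xs' = map d_bit xs \<and>
    map r_bit xs' = map r_bit xs \<and> bin_val (map lsb_mark xs') = of_bool (first \<and> xs \<noteq> []) \<and>
    (same' \<longleftrightarrow> same \<and> map a_bit xs = map r_bit xs) \<and>
    (r_one' \<longleftrightarrow> r_one \<and> bin_val (map r_bit xs) = of_bool (first \<and> xs \<noteq> []))"
    and "bin_val (map u0_bit xs') + 2 ^ length xs * c0' = 2 * bin_val (map r_bit xs) +
      of_bool b * bin_val (map (if e = 0 then a_bit else d_bit) xs) - 0 * bin_val (map p_bit xs) + c0"
    and "bin_val (map u1_bit xs') + 2 ^ length xs * c1' = 2 * bin_val (map r_bit xs) +
      of_bool b * bin_val (map (if e = 0 then a_bit else d_bit) xs) - 1 * bin_val (map p_bit xs) + c1"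
    and "bin_val (map u2_bit xs') + 2 ^ length xs * c2' = 2 * bin_val (map r_bit xs) +
      of_bool b * bin_val (map (if e = 0 then a_bit else d_bit) xs) - 2 * bin_val (map p_bit xs) + c2"
  using assms
proof (atomize(full), induction xs arbitrary: first same r_one c0 c1 c2 xs')
  case (Cons x xs)
  obtain p a d r mk u0 u1 u2 where x: "x = Col p a d r mk u0 u1 u2"
    by (cases x)
  define y where "y = (b \<and> (if e = 0 then a else d))"
  define t where "t j c = lin j p r y c" for j c
  obtain xs1 where scan: "scan e b (False, same \<and> (a \<longleftrightarrow> r), r_one \<and> (r \<longleftrightarrow> first),
      t 0 c0 div 2, t 1 c1 div 2, t 2 c2 div 2) xs
      = ((first', same', r_one', c0', c1', c2'), xs1)"
    and xs': "xs' = Col p a d r first (odd (t 0 c0)) (odd (t 1 c1)) (odd (t 2 c2)) # xs1"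
    using Cons.prems by (auto simp: x t_def y_def Let_def split: prod.splits)
  note IH = Cons.IH[OF scan]
  have digit: "of_bool (odd (t j c)) + 2 * U + 2 ^ length (x # xs) * c' =
      2 * (of_bool r + 2 * R) + of_bool b * (of_bool (if e = 0 then a else d) + 2 * Y) - j *
          (of_bool p + 2 * P) + c"
    if "U + 2 ^ length xs * c' = 2 * R + of_bool b * Y - j * P + t j c div 2" for j c U c' R Y P
  proof -
    have "of_bool (odd (t j c)) + 2 * U + 2 ^ length (x # xs) * c' = of_bool (odd (t j c)) + 2 * (U +
        2 ^ length xs * c')"
      by (simp add: algebra_simps)
    also have "\<dots> = of_bool (odd (t j c)) + 2 * (t j c div 2) + 2 * (2 * R + of_bool b * Y - j * P)"
      unfolding that by (simp add: algebra_simps)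
    also have "\<dots> = 2 * of_bool r + of_bool y - j * of_bool p + c + 2 * (2 * R + of_bool b * Y - j * P)"
      unfolding t_def lin_decomp by (simp add: lin_def)
    also have "\<dots> = 2 * (of_bool r + 2 * R) + of_bool b * (of_bool (if e = 0 then a else d) + 2 *
        Y) - j * (of_bool p + 2 * P) + c"
      by (cases b; cases "e = 0") (simp_all add: y_def algebra_simps)
    finally show ?thesis .
  qed
  have "of_bool r + 2 * bin_val (map r_bit xs) = of_bool first \<longleftrightarrow> (r \<longleftrightarrow> first) \<and> bin_val (map r_bit xs) = 0"
    using of_bool_plus_double_eq_iff[of r _ first 0] by simp
  then show ?case
    using IH digit[of _ _ _ _ 0] digit[of _ _ _ _ 1] digit[of _ _ _ _ 2]
    by (cases "e = 0") (auto simp: xs' x)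
qed simp

text \<open>The residue of \<open>2R + Y\<close> is the difference with the largest multiple of \<open>P\<close> for which the
  subtraction ends without a borrow.\<close>

lemma select_residue:
  fixes c0 c1 c2 :: int
  assumes "bin_val u0 + 2 ^ n * c0 = v" "bin_val u1 + 2 ^ n * c1 = v - P"
      "bin_val u2 + 2 ^ n * c2 = v - 2 * P"
    and len: "length u0 = n" "length u1 = n" "length u2 = n"
    and "0 \<le> v" "v < 3 * P" "P < 2 ^ n"
  shows "bin_val (if 0 \<le> c2 then u2 else if 0 \<le> c1 then u1 else u0) = v mod P"
proof -
  \<comment> \<open>The digits represent a number in \<open>[0, 2^n)\<close>, hence the total has
    the sign of the outgoing carry.\<close>
  have nonneg: "0 \<le> c \<longleftrightarrow> 0 \<le> w" if "bin_val u + 2 ^ n * c = w" "length u = n" for u c w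
  proof -
    have u: "0 \<le> bin_val u" "bin_val u < 2 ^ n"
      using bin_val_bounds[of u] that by auto
    show ?thesis
    proof (cases "0 \<le> c")
      case False
      then have "2 ^ n * c \<le> 2 ^ n * (- 1)"
        by (intro mult_left_mono) auto
      with False u that show ?thesis
        by simp
    qed (use u that in auto)
  qed
  have exact: "bin_val u = w" if "bin_val u + 2 ^ n * c = w" "length u = n" "0 \<le> w" "w < P" for u c w
  proof -
    have "(bin_val u + 2 ^ n * c) mod 2 ^ n = w mod 2 ^ n"
      by (simp add: that)
    moreover have "bin_val u mod 2 ^ n = bin_val u" "w mod 2 ^ n = w"
      using bin_val_bounds[of u] that assms(9) by auto
    ultimately show ?thesis
      by simp
  qed
  have mod_eq: "v mod P = v - j * P" if "0 \<le> v - j * P" "v - j * P < P" for j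
    using that by (metis diff_add_cancel mod_mult_self1 mod_pos_pos_trivial)
  note 0 = nonneg[OF assms(1) len(1)] exact[OF assms(1) len(1)] mod_eq[of 0]
  note 1 = nonneg[OF assms(2) len(2)] exact[OF assms(2) len(2)] mod_eq[of 1]
  note 2 = nonneg[OF assms(3) len(3)] exact[OF assms(3) len(3)] mod_eq[of 2]
  show ?thesis
    using 0 1 2 assms(7,8) by (cases "0 \<le> c2"; cases "0 \<le> c1") auto
qed

lemma update_col_bits:
  "p_bit (update_col e inp (f, sa, ro, c0, c1, c2) x) = p_bit x"
  "a_bit (update_col e inp (f, sa, ro, c0, c1, c2) x) =
    (if inp = 3 \<and> e = 4 then lsb_mark x else if inp = 3 \<and> e = 0 then r_bit x else a_bit x)"
  "d_bit (update_col e inp (f, sa, ro, c0, c1, c2) x) =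
    (if inp = 3 \<and> e = 4 then lsb_mark x else if inp = 3 \<and> e = 3 then r_bit x else d_bit x)"
  "r_bit (update_col e inp (f, sa, ro, c0, c1, c2) x) =
    (if inp = 3 then e \<notin> {0, 3, 4} \<and> r_bit x
     else if e \<in> {0, 3} then if 0 \<le> c2 then u2_bit x else if 0 \<le> c1 then u1_bit x else u0_bit x
     else r_bit x)"
  by (cases x; simp)+

lemma bin_val_map_False: "bin_val (map (\<lambda>x. False) xs) = 0"
  by (induction xs) auto

text \<open>A positive modulus occupies at least one column, so the marks have the value
  \<open>1\<close> and can initialise \<open>A\<close> and \<open>D\<close>.\<close>

lemma sweep_separator:
  assumes "regs xs = (P, A, D, R)" "0 < P" "e \<le> 4"
  shows "\<exists>xs'. sweep (e, z, s, odd_p) 3 xs =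
      ((if e \<ge> 3 then 0 else e + 1, False,
        if e = 1 \<and> z then add_unit_shape odd_p s else if e = 3 \<and> A \<noteq> R then 2 else s, odd_p), xs') \<and>
    regs xs' = (if e = 4 then (P, 1, 1, 0) else if e = 0 then (P, R, D, 0)
      else if e = 3 then (P, A, R, 0) else (P, A, D, R))"
proof -
  obtain f sa ro c0 c1 c2 ys where scan: "scan e False init_acc xs = ((f, sa, ro, c0, c1, c2), ys)"
    by (metis prod_cases6 surj_pair)
  have "xs \<noteq> []"
    using assms by (auto simp: regs_def)
  moreover have "map a_bit xs = map r_bit xs \<longleftrightarrow> A = R"
    using bin_val_eq_iff[of "map a_bit xs" "map r_bit xs"] assms by (simp add: regs_def)
  ultimately have ys: "map p_bit ys = map p_bit xs" "map a_bit ys = map a_bit xs"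
    "map d_bit ys = map d_bit xs"
    "map r_bit ys = map r_bit xs" "bin_val (map lsb_mark ys) = 1" "sa \<longleftrightarrow> A = R"
    using scan_correct(1)[OF scan[unfolded init_acc_def]] by auto
  consider "e = 0" | "e = 1" | "e = 2" | "e = 3" | "e = 4"
    using assms(3) by linarith
  then show ?thesis
    using assms(1) scan ys
    by cases (simp_all add: sweep_def regs_def update_col_bits bin_val_map_False comp_def)
qed

text \<open>One Horner step: \<open>R\<close>, \<open>A\<close> and \<open>D\<close> are below
  \<open>P\<close>, so \<open>2R + Y\<close> is below \<open>3P\<close> and three candidates
  suffice.\<close>

lemma sweep_digit:
  assumes regs: "regs xs = (P, A, D, R)" and "A \<in> {0..<P}" "D \<in> {0..<P}" "R \<in> {0..<P}" "inp \<noteq> 3"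
  shows "\<exists>xs'. sweep (e, z, s, odd_p) inp xs = ((e, z \<or> inp = 2, s, odd_p), xs') \<and>
    regs xs' = (P, A, D, if e \<in> {0, 3}
      then (2 * R + of_bool (inp = 2) * (if e = 0 then A else D)) mod P else R)"
proof -
  obtain f sa ro c0 c1 c2 ys where scan: "scan e (inp = 2) init_acc xs = ((f, sa, ro, c0, c1, c2), ys)"
    by (metis prod_cases6 surj_pair)
  note correct = scan_correct[OF scan[unfolded init_acc_def]]
  let ?v = "2 * R + of_bool (inp = 2) * (if e = 0 then A else D)"
  let ?u = "if 0 \<le> c2 then map u2_bit ys else if 0 \<le> c1 then map u1_bit ys else map u0_bit ys"
  have "length ys = length xs"
    using length_scan[OF scan] .
  moreover have "P < 2 ^ length xs"
    using bin_val_bounds(2)[of "map p_bit xs"] regs by (simp add: regs_def)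
  ultimately have "bin_val ?u = ?v mod P"
    using correct(2-4) assms
    by (intro select_residue[where n = "length xs" and ?c0.0 = c0]) (auto simp: regs_def)
  then have "bin_val (map (\<lambda>x. if 0 \<le> c2 then u2_bit x else if 0 \<le> c1 then u1_bit x else u0_bit x) ys) = ?v mod P"
    by (simp split: if_splits)
  then show ?thesis
    using regs scan correct(1) \<open>inp \<noteq> 3\<close>
    by (auto simp: sweep_def regs_def update_col_bits comp_def)
qed

section \<open>Horner's scheme over numbers and whole matrices\<close>

definition sweeps :: "ctrl \<times> col list \<Rightarrow> nat list \<Rightarrow> ctrl \<times> col list" where
  "sweeps = foldl (\<lambda>(g, xs) inp. sweep g inp xs)"

lemma sweeps_simps [simp]: "sweeps c [] = c" "sweeps (g, xs) (inp # v) = sweeps (sweep g inp xs) v"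
  "sweeps c (v @ w) = sweeps (sweeps c v) w"
  by (simp_all add: sweeps_def)

lemma process_append: "process g xs (v @ w) = (case sweeps (g, xs) v of (g', xs') \<Rightarrow> process g' xs' w)"
  by (induction v arbitrary: g xs) (auto split: prod.splits)

lemma sweeps_digits:
  assumes "regs xs = (P, A, D, R)" "A \<in> {0..<P}" "D \<in> {0..<P}" "R \<in> {0..<P}" "set v \<subseteq> {1, 2}"
  shows "\<exists>xs'. sweeps ((e, z, s, odd_p), xs) v = ((e, z \<or> 2 \<in> set v, s, odd_p), xs') \<and>
    regs xs' = (P, A, D, if e \<in> {0, 3}
      then foldl (\<lambda>r a. (2 * r + of_bool (a = 2) * (if e = 0 then A else D)) mod P) R v else R)"
  using assms
proof (induction v arbitrary: z xs R)
  case (Cons a v)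
  let ?R = "if e \<in> {0, 3} then (2 * R + of_bool (a = 2) * (if e = 0 then A else D)) mod P else R"
  have "a \<noteq> 3"
    using Cons.prems by auto
  then obtain xs1 where 1: "sweep (e, z, s, odd_p) a xs = ((e, z \<or> a = 2, s, odd_p), xs1)"
    "regs xs1 = (P, A, D, ?R)"
    using sweep_digit[OF Cons.prems(1-4)] by blast
  have "?R \<in> {0..<P}" "set v \<subseteq> {1, 2}"
    using Cons.prems by auto
  from Cons.IH[OF 1(2) Cons.prems(2,3) this, of "z \<or> a = 2"] show ?case
    by (auto simp: 1(1))
qed simp

lemma double_div_2_plus_mod_2: "2 * int (m div 2) + int (m mod 2) = int m"
  using div_mult_mod_eq[of m 2] by linarith

text \<open>Horner's scheme with the factor \<open>Y\<close> folded into each digit: the product is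
  formed while the number is read, so the matrix entry is never stored.\<close>

lemma foldl_bin:
  "foldl (\<lambda>r a. (2 * r + of_bool (a = 2) * Y) mod P) 0 (bin m) = (int m * Y) mod P" if "Y \<in> {0..<P}"
proof (induction m rule: bin.induct)
  case (1 m)
  show ?case
  proof (cases "m < 2")
    case True
    then consider "m = 0" | "m = 1"
      by linarith
    then show ?thesis
      using that by cases (simp_all add: bin.simps[of 0] bin.simps[of "Suc 0"])
  next
    case False
    have "(2 * (int (m div 2) * Y mod P) + of_bool (m mod 2 = 1) * Y) mod P =
        ((2 * int (m div 2) + int (m mod 2)) * Y) mod P"
      unfolding mod_lin by (cases "m mod 2 = 1") (simp_all add: algebra_simps)
    moreover have "2 * int (m div 2) + int (m mod 2) = int m"
      by (rule double_div_2_plus_mod_2)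
    ultimately show ?thesis
      using False 1 by (simp add: bin.simps[of m])
  qed
qed

lemma set_bin: "set (bin m) \<subseteq> {1, 2}"
  by (induction m rule: bin.induct) (subst bin.simps, auto)

lemma two_in_bin_iff: "2 \<in> set (bin m) \<longleftrightarrow> m \<noteq> 0"
  by (induction m rule: bin.induct) (subst bin.simps, auto)

lemma bin_nonempty: "bin m \<noteq> []"
  by (subst bin.simps) simp

lemma last_bin: "last (bin m) = 2 \<longleftrightarrow> odd m"
  by (subst bin.simps) (auto simp: odd_iff_mod_2_eq_one)

lemma bin_val_bin: "bin_val (rev (map (\<lambda>a. a = 2) (bin m))) = int m"
proof (induction m rule: bin.induct)
  case (1 m)
  have "2 * int (m div 2) + int (m mod 2) = int m"
    by (rule double_div_2_plus_mod_2)
  with 1 show ?case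
    by (subst bin.simps) (auto simp: of_bool_def mod2_eq_if)
qed

text \<open>A number is closed off only by the separator that follows it. So the last entry of the matrices
  read so far, which completes the product \<open>D\<close>, is still in the accumulator \<open>R\<close>.\<close>

definition pending :: "nat \<Rightarrow> ctrl \<times> col list \<Rightarrow> int \<times> int \<times> nat \<Rightarrow> bool" where
  "pending p c = (\<lambda>(A, D, s). A \<in> {0..<int p} \<and> D \<in> {0..<int p} \<and>
    ((\<exists>z. fst c = (4, z, 0, odd p) \<and> (A, D, s) = (1, 1, 0) \<and> (\<exists>a d r. regs (snd c) = (int p, a, d, r))) \<or>
     (\<exists>z D0 s0. fst c = (3, z, s0, odd p) \<and> regs (snd c) = (int p, A, D0, D) \<and>
       s = (if A = D then s0 else 2))))"

lemma sweep_pending: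
  assumes "pending p (g, xs) (A, D, s)"
  shows "\<exists>xs'. sweep g 3 xs = ((0, False, s, odd p), xs') \<and> regs xs' = (int p, A, D, 0)"
proof -
  have "0 < int p"
    using assms by (auto simp: pending_def)
  consider (init) z a d r where "g = (4, z, 0, odd p)" "A = 1" "D = 1" "s = 0" "regs xs = (int p, a, d, r)"
    | (mat) z D0 s0 where "g = (3, z, s0, odd p)" "regs xs = (int p, A, D0, D)"
      "s = (if A = D then s0 else 2)"
    using assms by (auto simp: pending_def)
  then show ?thesis
  proof cases
    case init
    then show ?thesis
      using sweep_separator[OF init(5) \<open>0 < int p\<close>, of 4 z 0 "odd p"] by simp
  next
    case mat
    then show ?thesis
      using sweep_separator[OF mat(2) \<open>0 < int p\<close>, of 3 z s0 "odd p"] by (cases "A = D") simp_all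
  qed
qed

text \<open>The chain follows the four entries. Each separator closes the preceding number, so the
  first one completes the previous matrix and the last entry stays pending.\<close>

lemma sweeps_enc_mat:
  assumes "pending p c (A, D, s)"
    and C: "C $ 1 $ 1 \<in> {0..<int p}" "C $ 1 $ 2 \<in> {0..<int p}" "C $ 2 $ 2 \<in> {0..<int p}"
  shows "pending p (sweeps c (enc_mat C)) (summary_step p (A, D, s) C) \<and> fst (fst (sweeps c (enc_mat C))) = 3"
proof -
  obtain g xs where c: "c = (g, xs)"
    by fastforce
  have A: "A \<in> {0..<int p}" and D: "D \<in> {0..<int p}"
    using assms by (auto simp: pending_def)
  then have p: "0 < int p" "0 \<in> {0..<int p}"
    by auto
  define a b d where "a = C $ 1 $ 1" and "b = C $ 1 $ 2" and "d = C $ 2 $ 2"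
  define A' D' where "A' = (a * A) mod int p" and "D' = (d * D) mod int p"
  have A': "A' \<in> {0..<int p}" and D': "D' \<in> {0..<int p}"
    using p by (simp_all add: A'_def D'_def)
  obtain xs1 where 1: "sweep g 3 xs = ((0, False, s, odd p), xs1)" "regs xs1 = (int p, A, D, 0)"
    using sweep_pending assms(1) unfolding c by blast
  obtain z2 xs2 where 2: "sweeps ((0, False, s, odd p), xs1) (bin (nat a)) = ((0, z2, s, odd p), xs2)"
    "regs xs2 = (int p, A, D, A')"
    using sweeps_digits[OF 1(2) A D p(2) set_bin, of 0 False s "odd p" "nat a"] C(1)
    by (auto simp: foldl_bin[OF A] A'_def a_def)
  obtain xs3 where 3: "sweep (0, z2, s, odd p) 3 xs2 = ((1, False, s, odd p), xs3)"
    "regs xs3 = (int p, A', D, 0)"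
    using sweep_separator[OF 2(2) p(1), of 0 z2 s "odd p"] by auto
  obtain xs4 where 4: "sweeps ((1, False, s, odd p), xs3) (bin (nat b)) = ((1, b \<noteq> 0, s, odd p), xs4)"
    "regs xs4 = (int p, A', D, 0)"
    using sweeps_digits[OF 3(2) A' D p(2) set_bin, of 1 False s "odd p" "nat b"] C(2)
    by (auto simp: two_in_bin_iff b_def)
  let ?s = "if b = 0 then s else add_unit_shape (odd p) s"
  obtain xs5 where 5: "sweep (1, b \<noteq> 0, s, odd p) 3 xs4 = ((2, False, ?s, odd p), xs5)"
    "regs xs5 = (int p, A', D, 0)"
    using sweep_separator[OF 4(2) p(1), of 1 "b \<noteq> 0" s "odd p"] by auto
  \<comment> \<open>The lower left entry is merely skipped: its digits change neither the registers
    nor the shape.\<close>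
  obtain z6 xs6 where 6: "sweeps ((2, False, ?s, odd p), xs5) (bin (nat (C $ 2 $ 1))) =
      ((2, z6, ?s, odd p), xs6)"
    "regs xs6 = (int p, A', D, 0)"
    using sweeps_digits[OF 5(2) A' D p(2) set_bin, of 2 False ?s "odd p" "nat (C $ 2 $ 1)"] by auto
  obtain xs7 where 7: "sweep (2, z6, ?s, odd p) 3 xs6 = ((3, False, ?s, odd p), xs7)"
    "regs xs7 = (int p, A', D, 0)"
    using sweep_separator[OF 6(2) p(1), of 2 z6 ?s "odd p"] by auto
  obtain z8 xs8 where 8: "sweeps ((3, False, ?s, odd p), xs7) (bin (nat d)) = ((3, z8, ?s, odd p), xs8)"
    "regs xs8 = (int p, A', D, D')"
    using sweeps_digits[OF 7(2) A' D p(2) set_bin, of 3 False ?s "odd p" "nat d"] C(3)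
    by (auto simp: foldl_bin[OF D] D'_def d_def)
  have "sweeps c (enc_mat C) = ((3, z8, ?s, odd p), xs8)"
    by (simp add: c enc_mat_def 1 2 3 4 5 6 7 8 flip: a_def b_def d_def del: One_nat_def)
  moreover have "summary_step p (A, D, s) C = (A', D', if A' = D' then ?s else 2)"
    by (simp add: summary_step_def Let_def A'_def D'_def a_def b_def d_def mult.commute)
  ultimately show ?thesis
    using A' D' 8(2) by (simp add: pending_def)
qed

lemma accepts_pending:
  assumes "pending p ((e, z, s0, odd_p), xs) (A, D, s)" "e = 3" "1 < p"
  shows "process (e, z, s0, odd_p) xs [] \<longleftrightarrow> A = 1 \<and> D = 1 \<and> s \<noteq> 1"
proof -
  obtain D0 where regs: "regs xs = (int p, A, D0, D)" and s: "s = (if A = D then s0 else 2)"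
    using assms by (auto simp: pending_def)
  obtain f sa ro c0 c1 c2 ys where scan: "scan e False init_acc xs = ((f, sa, ro, c0, c1, c2), ys)"
    by (metis prod_cases6 surj_pair)
  have "xs \<noteq> []"
    using regs assms(3) by (auto simp: regs_def)
  moreover have "map a_bit xs = map r_bit xs \<longleftrightarrow> A = D"
    using bin_val_eq_iff[of "map a_bit xs" "map r_bit xs"] regs by (simp add: regs_def)
  ultimately have "sa \<longleftrightarrow> A = D" "ro \<longleftrightarrow> D = 1"
    using scan_correct(1)[OF scan[unfolded init_acc_def]] regs by (auto simp: regs_def)
  then show ?thesis
    using scan s by auto
qed

text \<open>The condition \<open>fst g = 3 \<or> Cs \<noteq> []\<close> keeps \<open>accepts\<close>
  from being consulted before the first separator has initialised the registers.\<close>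

lemma process_enc_mats:
  assumes "pending p (g, xs) (A, D, s)" "fst g = 3 \<or> Cs \<noteq> []" "1 < p"
    and "\<forall>C\<in>set Cs. C $ 1 $ 1 \<in> {0..<int p} \<and> C $ 1 $ 2 \<in> {0..<int p} \<and> C $ 2 $ 2 \<in> {0..<int p}"
  shows "process g xs (concat (map enc_mat Cs)) \<longleftrightarrow>
    (case foldl (summary_step p) (A, D, s) Cs of (A', D', s') \<Rightarrow> A' = 1 \<and> D' = 1 \<and> s' \<noteq> 1)"
  using assms
proof (induction Cs arbitrary: g xs A D s)
  case Nil
  obtain e z s0 odd_p where "g = (e, z, s0, odd_p)"
    by (metis prod_cases4)
  with Nil accepts_pending show ?case
    by (simp del: process.simps)
next
  case (Cons C Cs)
  obtain g' xs' where 1: "sweeps (g, xs) (enc_mat C) = (g', xs')"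
    by fastforce
  obtain A' D' s' where 2: "summary_step p (A, D, s) C = (A', D', s')"
    by (metis prod_cases3)
  have "pending p (g', xs') (A', D', s')" "fst g' = 3"
    using sweeps_enc_mat[OF Cons.prems(1), of C] Cons.prems(4) 1 2 by auto
  from Cons.IH[OF this(1)] this(2) Cons.prems show ?case
    by (simp add: process_append 1 2 del: process.simps)
qed

section \<open>Complete encoded instances\<close>

lemma read_prime_digits:
  assumes "v \<noteq> []" "set v \<subseteq> {1, 2}"
  shows "read_prime odd_p xs (v @ w) = read_prime (last v = 2) (rev (map (\<lambda>a. digit_col (a = 2)) v) @ xs) w"
  using assms
proof (induction v arbitrary: odd_p xs)
  case (Cons a v)
  then show ?case
    by (cases v) auto
qed simp

lemma read_prime_enc_instance:
  assumes "1 < p"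
    and "\<forall>C\<in>set Cs. C $ 1 $ 1 \<in> {0..<int p} \<and> C $ 1 $ 2 \<in> {0..<int p} \<and> C $ 2 $ 2 \<in> {0..<int p}"
  shows "read_prime False [] (enc_instance (p, Cs)) \<longleftrightarrow>
    (case foldl (summary_step p) (1, 1, 0) Cs of (A, D, s) \<Rightarrow> A = 1 \<and> D = 1 \<and> s \<noteq> 1)"
proof -
  let ?xs = "rev (map (\<lambda>a. digit_col (a = 2)) (bin p))"
  have "read_prime False [] (enc_instance (p, Cs)) = read_prime (odd p) ?xs (concat (map enc_mat Cs))"
    by (simp add: enc_instance_def read_prime_digits[OF bin_nonempty set_bin] last_bin)
  also have "\<dots> \<longleftrightarrow> (case foldl (summary_step p) (1, 1, 0) Cs of (A, D, s) \<Rightarrow> A = 1 \<and> D = 1 \<and> s \<noteq> 1)"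
  \<comment> \<open>Without matrices no sweep takes place; the value \<open>True\<close> of
    \<open>read_prime\<close> at the end of the input agrees with the summary
    \<open>(1, 1, 0)\<close>.\<close>
  proof (cases Cs)
    case (Cons C Cs')
    have "bin_val (map p_bit ?xs) = int p"
      using bin_val_bin[of p] by (simp add: rev_map comp_def digit_col_def)
    then have "pending p ((4, False, 0, odd p), ?xs) (1, 1, 0)"
      using assms(1) by (auto simp: pending_def regs_def intro: exI[of _ False])
    then have "process (4, False, 0, odd p) ?xs (concat (map enc_mat Cs)) \<longleftrightarrow>
      (case foldl (summary_step p) (1, 1, 0) Cs of (A, D, s) \<Rightarrow> A = 1 \<and> D = 1 \<and> s \<noteq> 1)"
      by (rule process_enc_mats) (use assms Cons in auto)
    moreover have "read_prime (odd p) ?xs (concat (map enc_mat Cs)) =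
        process (4, False, 0, odd p) ?xs (concat (map enc_mat Cs))"
      by (simp add: Cons enc_mat_def del: process.simps)
    ultimately show ?thesis
      by simp
  qed simp
  finally show ?thesis .
qed

lemma enc_instance_in_lists: "enc_instance (p, Cs) \<in> lists {1..3}"
proof -
  have bin: "set (bin m) \<subseteq> {1..3}" for m
    using set_bin[of m] by auto
  have "set (enc_mat C) \<subseteq> {1..3}" for C
    using bin by (simp add: enc_mat_def)
  then show ?thesis
    using bin by (simp add: enc_instance_def lists_eq_set UN_subset_iff)
qed

text \<open>The witness is the language of the sweeping machine. On encodings of instances,
  acceptance and solvability are both expressed by the summary \<open>(A, D, s)\<close>, which links
  the machine to the group.\<close>

theorem theorem28:
  shows "problem_in_P 3 enc_instance
    {(p, Cs). prime p \<and> set Cs \<subseteq> carrier (T2 p)}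
    (\<lambda>(p, Cs). \<exists>Zs. length Zs = length Cs \<and> set Zs \<subseteq> carrier (T2 p) \<and>
       foldr (\<otimes>\<^bsub>T2 p\<^esub>) (map2 (\<lambda>Z C. inv\<^bsub>T2 p\<^esub> Z \<otimes>\<^bsub>T2 p\<^esub> C \<otimes>\<^bsub>T2 p\<^esub> Z) Zs Cs) \<one>\<^bsub>T2 p\<^esub>
         = \<one>\<^bsub>T2 p\<^esub>)"
  unfolding problem_in_P_def
proof (intro bexI[OF _ read_prime_in_class_P] ballI, clarify, intro conjI)
  fix p :: nat and Cs :: "(int ^ 2 ^ 2) list"
  assume p: "prime p" and Cs: "set Cs \<subseteq> carrier (T2 p)"
  show lists: "enc_instance (p, Cs) \<in> lists {1..3}"
    by (rule enc_instance_in_lists)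
  interpret T2_prime p "int p" "T2 p"
    by unfold_locales (use p in simp_all)
  obtain A D s where summary: "foldl (summary_step p) (1, 1, 0) Cs = (A, D, s)"
    by (metis prod_cases3)
  have "\<forall>C\<in>set Cs. C $ 1 $ 1 \<in> {0..<int p} \<and> C $ 1 $ 2 \<in> {0..<int p} \<and> C $ 2 $ 2 \<in> {0..<int p}"
    using Cs by (force simp: carrier_G)
  then have "read_prime False [] (enc_instance (p, Cs)) \<longleftrightarrow> A = 1 \<and> D = 1 \<and> s \<noteq> 1"
    using read_prime_enc_instance[of p Cs] prime_gt_1_nat[OF p] summary by simp
  then show "enc_instance (p, Cs) \<in> {w \<in> lists {1..3}. read_prime False [] w} \<longleftrightarrow>
    (\<exists>Zs. length Zs = length Cs \<and> set Zs \<subseteq> carrier (T2 p) \<and>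
       foldr (\<otimes>\<^bsub>T2 p\<^esub>) (map2 (\<lambda>Z C. inv\<^bsub>T2 p\<^esub> Z \<otimes>\<^bsub>T2 p\<^esub> C \<otimes>\<^bsub>T2 p\<^esub> Z) Zs Cs) \<one>\<^bsub>T2 p\<^esub>
         = \<one>\<^bsub>T2 p\<^esub>)"
    using lists conj_product_eq_one_iff[OF Cs summary] by simp
qed

end
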